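(* Let $\gamma\in\mathbb{R}$ and let $G:[0,1]\to\mathbb{R}$ be an absolutely continuous distribution function with density function $g\in L^2([0,1])$ (i.e. $g=G'$ almost everywhere). Let $(X_n)_{n\in\mathbb{N}}$ be a sequence of independent random variables on a probability space $(\Omega,\Sigma,\mathbb{P})$, each uniformly distributed with respect to $G$, i.e. $\mathbb{P}(X_n<t)=G(t)$ for all $t\in[0,1]$. Then almost surely, $$\lim_{N\to\infty}R_2(\gamma;s,N)=2s\int_0^1 g(x)g(x+\gamma)\,\mathrm{d}x\qquad\text{for all } s>0,$$ where $R_2(\gamma;s,N)$ is the $\gamma$-pair correlation function of $(X_n)_{n\in\mathbb{N}}$.
   Context: For $x\in\mathbb{R}$, $\|x\|=\min\{|x-k|:k\in\mathbb{Z}\}$. For a sequence $(x_n)_{n\in\mathbb{N}}\subseteq[0,1]$, $\gamma\in\mathbb{R}$, $s>0$ and $N\in\mathbb{N}$, the $\gamma$-pair correlation function is $$R_2(\gamma;s,N)=\frac{1}{N}\#\Big\{1\leqslant m\neq n\leqslant N:\ \|x_m-x_n-\gamma\|\leqslant \frac{s}{N}\Big\}.$$ In the integral $\int_0^1 g(x)g(x+\gamma)\,\mathrm{d}x$ the function $g$ is extended to $\mathbb{R}$ periodically with period $1$ (so $g(x+\gamma)$ means $g(\{x+\gamma\})$, with $\{\cdot\}$ the fractional part). *)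

theory Defs
  imports "HOL-Probability.Probability"
begin

text \<open>
  Distance to the nearest integer, \<open>\<parallel>x\<parallel>\<close>. The infimum is a minimum, see
  \<open>dist_nearest_int_attained\<close> and \<open>dist_nearest_int_le\<close>.
\<close>

definition dist_nearest_int :: "real \<Rightarrow> real" where
  "dist_nearest_int x = (INF k::int. \<bar>x - of_int k\<bar>)"

lemma dist_nearest_int_le: "dist_nearest_int x \<le> \<bar>x - of_int k\<bar>"
  unfolding dist_nearest_int_def by (rule cINF_lower) (auto intro!: bdd_belowI[of _ 0])

lemma dist_nearest_int_attained: "\<exists>k::int. dist_nearest_int x = \<bar>x - of_int k\<bar>"
proof
  show "dist_nearest_int x = \<bar>x - of_int (round x)\<bar>"
  proof (rule antisym)
    show "\<bar>x - of_int (round x)\<bar> \<le> dist_nearest_int x"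
      unfolding dist_nearest_int_def
      by (rule cINF_greatest) (use round_diff_minimal in auto)
  qed (rule dist_nearest_int_le)
qed

definition pair_correlation :: "real \<Rightarrow> real \<Rightarrow> nat \<Rightarrow> (nat \<Rightarrow> real) \<Rightarrow> real" where
  "pair_correlation \<gamma> s N x =
     1 / real N * real (card {(m, n). m \<in> {1..N} \<and> n \<in> {1..N} \<and> m \<noteq> n \<and>
                                dist_nearest_int (x m - x n - \<gamma>) \<le> s / real N})"

text \<open>
  Absolute continuity of a function on \<open>[a, b]\<close>; the library's \<^const>\<open>absolutely_continuous\<close>
  is the relation between measures. Degenerate intervals contribute nothing to either sum.
\<close>

definition abs_continuous_on_interval :: "real \<Rightarrow> real \<Rightarrow> (real \<Rightarrow> real) \<Rightarrow> bool" where
  "abs_continuous_on_interval a b F \<longleftrightarrow>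
     (\<forall>\<epsilon>>0. \<exists>\<delta>>0. \<forall>(n::nat) l r.
        (\<forall>i<n. a \<le> l i \<and> l i \<le> r i \<and> r i \<le> b) \<longrightarrow>
        (\<forall>i<n. \<forall>j<n. i \<noteq> j \<longrightarrow> {l i<..<r i} \<inter> {l j<..<r j} = {}) \<longrightarrow>
        (\<Sum>i<n. r i - l i) < \<delta> \<longrightarrow>
        (\<Sum>i<n. \<bar>F (r i) - F (l i)\<bar>) < \<epsilon>)"

text \<open>
  Distribution functions on \<open>[0, 1]\<close>, as in uniform distribution theory. Values outside
  \<open>[0, 1]\<close> are irrelevant.
\<close>

definition distribution_function01 :: "(real \<Rightarrow> real) \<Rightarrow> bool" where
  "distribution_function01 G \<longleftrightarrow> mono_on {0..1} G \<and> G 0 = 0 \<and> G 1 = 1"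

definition in_L2_01 :: "(real \<Rightarrow> real) \<Rightarrow> bool" where
  "in_L2_01 g \<longleftrightarrow> g \<in> borel_measurable (lebesgue_on {0..1}) \<and>
                  integrable (lebesgue_on {0..1}) (\<lambda>x. (g x)\<^sup>2)"

text \<open>Only the values of \<open>G\<close> on \<open>[0, 1]\<close> enter, hence the derivative within that set.\<close>

definition is_density_of :: "(real \<Rightarrow> real) \<Rightarrow> (real \<Rightarrow> real) \<Rightarrow> bool" where
  "is_density_of g G \<longleftrightarrow>
     (AE x in lebesgue_on {0..1}. (G has_real_derivative g x) (at x within {0..1}))"

end

theory Submission
  imports Defs "HOL-Real_Asymp.Real_Asymp"
begin

text \<open>
  Write \<open>arc \<epsilon> c\<close> for the probability that one \<open>X\<^sub>n\<close> falls within \<open>\<epsilon>\<close> of \<open>c\<close> on the circle. By the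
  Cauchy-Schwarz inequality \<open>arc \<epsilon> c\<close> is at most \<open>sqrt (2\<epsilon>K)\<close>, where \<open>K\<close> is the integral of \<open>g\<^sup>2\<close>, and
  the quotients \<open>arc \<epsilon> (y + \<gamma>) / 2\<epsilon>\<close> do not exceed \<open>g\<close> in \<open>L\<^sup>2\<close>-norm. Since they converge almost everywhere
  to \<open>g(y + \<gamma>)\<close>, they converge weakly in \<open>L\<^sup>2\<close>; tested against \<open>g\<close> this gives the limit of the
  expectations of \<open>R\<^sub>2(\<gamma>; s, N)\<close>. Indicators of pairs with disjoint indices are uncorrelated, and two pairs
  sharing one index contribute at most \<open>2\<epsilon>K sqrt (2\<epsilon>K)\<close> with \<open>\<epsilon> = s/N\<close>, so the variance of
  \<open>R\<^sub>2(\<gamma>; s, N)\<close> is \<open>O(1/sqrt N)\<close>. This is summable along \<open>N = k\<^sup>4\<close>, which yields almost sure convergence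
  there for all rational \<open>s\<close>, and monotonicity of the pair count in \<open>s\<close> and \<open>N\<close> fills the gaps.
\<close>

section \<open>The fundamental theorem of calculus for absolutely continuous functions\<close>

text \<open>The clause of absolute continuity for one fixed pair, named so that a chosen
  \<open>\<delta>\<close> can be handed to subintervals and to tagged divisions.\<close>

definition ac_modulus :: "real \<Rightarrow> real \<Rightarrow> (real \<Rightarrow> real) \<Rightarrow> real \<Rightarrow> real \<Rightarrow> bool" where
  "ac_modulus a b F \<epsilon> \<delta> \<longleftrightarrow> (\<forall>(n::nat) l r.
        (\<forall>i<n. a \<le> l i \<and> l i \<le> r i \<and> r i \<le> b) \<longrightarrow>
        (\<forall>i<n. \<forall>j<n. i \<noteq> j \<longrightarrow> {l i<..<r i} \<inter> {l j<..<r j} = {}) \<longrightarrow>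
        (\<Sum>i<n. r i - l i) < \<delta> \<longrightarrow>
        (\<Sum>i<n. \<bar>F (r i) - F (l i)\<bar>) < \<epsilon>)"

lemma abs_continuous_on_interval_iff_modulus:
  "abs_continuous_on_interval a b F \<longleftrightarrow> (\<forall>\<epsilon>>0. \<exists>\<delta>>0. ac_modulus a b F \<epsilon> \<delta>)"
  unfolding abs_continuous_on_interval_def ac_modulus_def ..

lemma ac_modulus_subset:
  assumes "ac_modulus a b F \<epsilon> \<delta>" "a \<le> c" "d \<le> b"
  shows "ac_modulus c d F \<epsilon> \<delta>"
  unfolding ac_modulus_def
proof (intro allI impI)
  fix n :: nat and l r :: "nat \<Rightarrow> real"
  assume "\<forall>i<n. c \<le> l i \<and> l i \<le> r i \<and> r i \<le> d"
    and *: "\<forall>i<n. \<forall>j<n. i \<noteq> j \<longrightarrow> {l i<..<r i} \<inter> {l j<..<r j} = {}" "(\<Sum>i<n. r i - l i) < \<delta>"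
  then have "\<forall>i<n. a \<le> l i \<and> l i \<le> r i \<and> r i \<le> b"
    using assms(2,3) by (meson order_trans)
  with * show "(\<Sum>i<n. \<bar>F (r i) - F (l i)\<bar>) < \<epsilon>"
    using assms(1)[unfolded ac_modulus_def, rule_format, of n l r] by blast
qed

lemma abs_continuous_on_interval_subset:
  "abs_continuous_on_interval a b F \<Longrightarrow> a \<le> c \<Longrightarrow> d \<le> b \<Longrightarrow> abs_continuous_on_interval c d F"
  unfolding abs_continuous_on_interval_iff_modulus by (meson ac_modulus_subset)

text \<open>Enumerated as intervals \<open>{l i..r i}\<close>, the cells of \<open>q\<close> have
  disjoint interiors and lie in \<open>U\<close>, so their total length stays below
  \<open>\<delta>\<close> and the modulus applies.\<close>

lemma sum_increment_less_of_abs_continuous: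
  fixes q :: "(real \<times> real set) set"
  assumes \<delta>: "ac_modulus a b F e \<delta>"
    and q: "q tagged_partial_division_of {a..b}" "\<And>x K. (x, K) \<in> q \<Longrightarrow> K \<subseteq> U"
    and U: "U \<in> lmeasurable" "measure lebesgue U < \<delta>"
  shows "(\<Sum>(x, K)\<in>q. \<bar>F (Sup K) - F (Inf K)\<bar>) < e"
proof -
  note qD = tagged_partial_division_ofD[OF q(1)]
  obtain h where h: "bij_betw h {0..<card q} q"
    using ex_bij_betw_nat_finite[OF qD(1)] by auto
  define n where "n = card q"
  have h: "bij_betw h {..<n} q"
    using h by (simp add: n_def atLeast0LessThan)
  define l where "l i = Inf (snd (h i))" for i
  define r where "r i = Sup (snd (h i))" for i
  have K: "snd (h i) = {l i..r i} \<and> a \<le> l i \<and> l i \<le> r i \<and> r i \<le> b \<and> {l i..r i} \<subseteq> U" if "i < n" for i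
  proof -
    have hi: "(fst (h i), snd (h i)) \<in> q" using h that by (auto simp: bij_betw_def)
    obtain u v where uv: "snd (h i) = {u..v}" using qD(4)[OF hi] by (auto simp: box_real)
    have "u \<le> v" using qD(2)[OF hi] uv by auto
    with qD(3)[OF hi] q(2)[OF hi] uv show ?thesis by (auto simp: l_def r_def)
  qed
  have disj: "{l i<..<r i} \<inter> {l j<..<r j} = {}" if ij: "i < n" "j < n" "i \<noteq> j" for i j
  proof -
    have "h i \<in> q" "h j \<in> q" "h i \<noteq> h j"
      using h ij by (auto simp: bij_betw_def dest: inj_onD)
    then have "interior (snd (h i)) \<inter> interior (snd (h j)) = {}"
      using qD(5)[of "fst (h i)" "snd (h i)" "fst (h j)" "snd (h j)"] by auto
    then show ?thesis using K[OF ij(1)] K[OF ij(2)] by simp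
  qed
  have "(\<Sum>i<n. r i - l i) = (\<Sum>i<n. measure lebesgue {l i<..<r i})"
    using K by (intro sum.cong) auto
  also have "\<dots> = measure lebesgue (\<Union>i<n. {l i<..<r i})"
    using disj K by (intro measure_finite_Union[symmetric]) (auto simp: disjoint_family_on_def simp del: Int_greaterThanLessThan)
  also have "\<dots> \<le> measure lebesgue U"
    using K U(1) by (intro measure_mono_fmeasurable) (auto simp: subset_iff)
  also have "\<dots> < \<delta>" by fact
  finally have "(\<Sum>i<n. \<bar>F (r i) - F (l i)\<bar>) < e"
    using \<delta>[unfolded ac_modulus_def, rule_format, of n l r] K disj by auto
  also have "(\<Sum>i<n. \<bar>F (r i) - F (l i)\<bar>) = (\<Sum>(x, K)\<in>q. \<bar>F (Sup K) - F (Inf K)\<bar>)"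
    using sum.reindex_bij_betw[OF h, of "\<lambda>(x, K). \<bar>F (Sup K) - F (Inf K)\<bar>"]
    by (simp add: l_def r_def split_beta)
  finally show ?thesis .
qed

text \<open>Gauge integration: at tags off \<open>N\<close> differentiability controls the error of
  each cell. Tags in \<open>N\<close> carry the integrand value 0 and a gauge that forces their
  cells into a small open set, where absolute continuity bounds the increments of
  \<open>F\<close>.\<close>

theorem fundamental_theorem_of_calculus_abs_continuous:
  fixes F f :: "real \<Rightarrow> real"
  assumes "a \<le> b" and ac: "abs_continuous_on_interval a b F" and N: "negligible N"
    and der: "\<And>x. x \<in> {a..b} - N \<Longrightarrow> (F has_real_derivative f x) (at x within {a..b})"
  shows "(f has_integral (F b - F a)) {a..b}"
proof -
  define f0 where "f0 x = (if x \<in> N then 0 else f x)" for x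
  have "(f0 has_integral (F b - F a)) {a..b}"
    unfolding has_integral_real
  proof (intro allI impI)
    fix e :: real assume "e > 0"
    \<comment> \<open>The summand 1 keeps the denominator positive when
      \<open>a = b\<close>.\<close>
    define e1 where "e1 = e / (2 * (b - a + 1))"
    have e1: "e1 > 0" "e1 * (b - a) \<le> e / 2"
      using \<open>e > 0\<close> \<open>a \<le> b\<close> by (auto simp: e1_def field_simps)
    have "\<exists>d>0. x \<in> {a..b} - N \<longrightarrow>
         (\<forall>y\<in>{a..b}. norm (y-x) < d \<longrightarrow> norm (F y - F x - (y-x) * f x) \<le> e1 * norm (y-x))" for x
    proof (cases "x \<in> {a..b} - N")
      case True
      from der[OF this] e1(1) show ?thesis
        unfolding has_field_derivative_def has_derivative_within_alt
        by (auto simp: mult.commute)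
    qed (auto intro: exI[of _ 1])
    then obtain d where d: "\<And>x. 0 < d x"
        "\<And>x y. x \<in> {a..b} - N \<Longrightarrow> y \<in> {a..b} \<Longrightarrow> norm (y-x) < d x \<Longrightarrow>
          norm (F y - F x - (y-x) * f x) \<le> e1 * norm (y-x)"
      by metis
    from ac \<open>e > 0\<close> obtain \<delta> where "\<delta> > 0" and \<delta>: "ac_modulus a b F (e / 2) \<delta>"
      unfolding abs_continuous_on_interval_iff_modulus by (meson half_gt_zero)
    have "N \<in> lmeasurable"
      using N negligible_iff_measure by blast
    \<comment> \<open>Outer regularity: as \<open>N\<close> is null, this open superset has measure
      below \<open>\<delta>\<close>.\<close>
    obtain U where U: "open U" "N \<subseteq> U" "U - N \<in> lmeasurable" "emeasure lebesgue (U - N) < ennreal \<delta>"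
      using sets_lebesgue_outer_open[OF fmeasurableD[OF \<open>N \<in> lmeasurable\<close>] \<open>\<delta> > 0\<close>] by blast
    have "(U - N) \<union> N \<in> lmeasurable"
      using U(3) \<open>N \<in> lmeasurable\<close> by (rule fmeasurable.Un)
    then have "U \<in> lmeasurable"
      using U(2) by (simp add: Un_absorb2)
    have "measure lebesgue U = measure lebesgue (U - N)"
      using N \<open>U \<in> lmeasurable\<close> by (simp add: measure_Diff_null_set negligible_iff_null_sets)
    also have "\<dots> < \<delta>"
      using U(3,4) \<open>\<delta> > 0\<close> by (simp add: emeasure_eq_measure2 ennreal_less_iff)
    finally have "measure lebesgue U < \<delta>" .
    define gam where "gam x = (if x \<in> N then U else ball x (d x))" for x
    have "gauge gam"
      using U(1,2) d(1) by (auto simp: gauge_def gam_def)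
    moreover have "norm ((\<Sum>(x,k)\<in>p. measure lborel k *\<^sub>R f0 x) - (F b - F a)) < e"
      if p: "p tagged_division_of {a..b}" and fine: "gam fine p" for p
    proof -
      note pD = tagged_division_ofD[OF p]
      define q where "q = {(x, K) \<in> p. x \<in> N}"
      have "q \<subseteq> p" by (auto simp: q_def)
      then have q: "q tagged_partial_division_of {a..b}"
        using p tagged_partial_division_subset by (auto simp: tagged_division_of_def)
      have qU: "K \<subseteq> U" if "(x, K) \<in> q" for x K
        using that fineD[OF fine, of x K] by (simp add: q_def gam_def)
      have q_bound: "(\<Sum>(x, K)\<in>q. \<bar>F (Sup K) - F (Inf K)\<bar>) < e / 2"
        by (rule sum_increment_less_of_abs_continuous[OF \<delta> q _ \<open>U \<in> lmeasurable\<close> \<open>measure lebesgue U < \<delta>\<close>]) (rule qU)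
      let ?D = "\<lambda>(x, K). measure lborel K * f0 x - (F (Sup K) - F (Inf K))"
      have ba: "b - a = (\<Sum>(x,K)\<in>p. Sup K - Inf K)" "F b - F a = (\<Sum>(x,K)\<in>p. F(Sup K) - F(Inf K))"
        using additive_tagged_division_1[OF \<open>a \<le> b\<close> p, where f= "\<lambda>x. x"]
          additive_tagged_division_1[OF \<open>a \<le> b\<close> p, where f= F] by auto
      have ne: "Inf K \<le> Sup K" if "(x, K) \<in> p" for x K
        using pD(2)[OF that] pD(4)[OF that] by (auto simp: box_real)
      \<comment> \<open>The tag \<open>x\<close> lies between the endpoints \<open>u\<close> and
        \<open>v\<close> of its cell, so the two errors \<open>e1 * \<bar>u - x\<bar>\<close> and
        \<open>e1 * \<bar>v - x\<bar>\<close> add up to \<open>e1\<close> times the cell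
        length.\<close>
      have "\<bar>\<Sum>z\<in>p - q. ?D z\<bar> \<le> (\<Sum>z\<in>p - q. e1 * (Sup (snd z) - Inf (snd z)))"
      proof (rule order_trans[OF sum_abs], rule sum_mono, clarsimp)
        fix x K assume xK: "(x, K) \<in> p" "(x, K) \<notin> q"
        then have "x \<notin> N" by (auto simp: q_def)
        have x: "x \<in> K" "x \<in> {a..b}" using pD(2,3)[OF xK(1)] by auto
        obtain u v where K: "K = {u..v}" using pD(4)[OF xK(1)] by (auto simp: box_real)
        have uv: "u \<le> x" "x \<le> v" "a \<le> u" "v \<le> b" "u \<le> v"
          using x K pD(3)[OF xK(1)] by auto
        have "K \<subseteq> ball x (d x)" using fineD[OF fine xK(1)] \<open>x \<notin> N\<close> by (simp add: gam_def)
        moreover have "u \<in> K" "v \<in> K" using uv K by auto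
        ultimately have ball: "\<bar>u - x\<bar> < d x" "\<bar>v - x\<bar> < d x" by (auto simp: dist_real_def abs_minus_commute)
        have "\<bar>F u - F x - (u - x) * f x\<bar> \<le> e1 * \<bar>u - x\<bar>" "\<bar>F v - F x - (v - x) * f x\<bar> \<le> e1 * \<bar>v - x\<bar>"
          using d(2)[of x u] d(2)[of x v] uv x(2) \<open>x \<notin> N\<close> ball by auto
        moreover have "e1 * \<bar>u - x\<bar> + e1 * \<bar>v - x\<bar> = e1 * (v - u)" using uv by (simp add: algebra_simps)
        ultimately have "\<bar>(v - u) * f x - (F v - F u)\<bar> \<le> e1 * (v - u)"
          by (simp add: left_diff_distrib)
        then show "\<bar>measure lborel K * f0 x - (F (Sup K) - F (Inf K))\<bar> \<le> e1 * (Sup K - Inf K)"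
          using uv \<open>x \<notin> N\<close> by (simp add: K f0_def)
      qed
      also have "\<dots> \<le> (\<Sum>z\<in>p. e1 * (Sup (snd z) - Inf (snd z)))"
        using pD(1) ne e1(1) by (intro sum_mono2) auto
      also have "\<dots> = e1 * (b - a)"
        using ba(1) by (simp add: sum_distrib_left split_beta)
      finally have 1: "\<bar>\<Sum>z\<in>p - q. ?D z\<bar> \<le> e / 2" using e1(2) by linarith
      have "\<bar>\<Sum>z\<in>q. ?D z\<bar> \<le> (\<Sum>(x, K)\<in>q. \<bar>F (Sup K) - F (Inf K)\<bar>)"
        by (rule order_trans[OF sum_abs], rule sum_mono) (auto simp: q_def f0_def)
      with q_bound have 2: "\<bar>\<Sum>z\<in>q. ?D z\<bar> < e / 2" by linarith
      have "(\<Sum>(x,k)\<in>p. measure lborel k *\<^sub>R f0 x) - (F b - F a) = (\<Sum>z\<in>p. ?D z)"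
        unfolding ba(2) by (simp add: sum_subtractf split_beta)
      also have "\<dots> = (\<Sum>z\<in>p - q. ?D z) + (\<Sum>z\<in>q. ?D z)"
        using sum.subset_diff[OF \<open>q \<subseteq> p\<close> pD(1)] by auto
      finally show ?thesis using 1 2 by simp
    qed
    ultimately show "\<exists>\<gamma>. gauge \<gamma> \<and> (\<forall>p. p tagged_division_of {a..b} \<and> \<gamma> fine p \<longrightarrow>
        norm ((\<Sum>(x,k)\<in>p. measure lborel k *\<^sub>R f0 x) - (F b - F a)) < e)"
      by (intro exI[of _ gam] conjI allI impI) (assumption, elim conjE, assumption)
  qed
  then show ?thesis
    by (rule has_integral_spike[OF N, rotated]) (auto simp: f0_def)
qed

section \<open>Distance to the nearest integer and translations of the circle\<close>

text \<open>Only the floor and its successor compete for the nearest integer. The formula gives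
  Borel measurability and shows that the distance depends on the fractional part alone.\<close>

lemma dist_nearest_int_eq_min: "dist_nearest_int x = min (frac x) (1 - frac x)"
proof (rule antisym)
  show "dist_nearest_int x \<le> min (frac x) (1 - frac x)"
    using dist_nearest_int_le[of x "\<lfloor>x\<rfloor>"] dist_nearest_int_le[of x "\<lfloor>x\<rfloor> + 1"] frac_ge_0[of x] frac_lt_1[of x]
    by (auto simp: frac_def)
  obtain k where k: "dist_nearest_int x = \<bar>x - of_int k\<bar>"
    using dist_nearest_int_attained by blast
  show "min (frac x) (1 - frac x) \<le> dist_nearest_int x"
  proof (cases "k \<le> \<lfloor>x\<rfloor>")
    case True
    then have "real_of_int k \<le> of_int \<lfloor>x\<rfloor>" by simp
    then show ?thesis using k of_int_floor_le[of x] unfolding frac_def by linarith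
  next
    case False
    then have "real_of_int k \<ge> of_int \<lfloor>x\<rfloor> + 1" by linarith
    then show ?thesis using k frac_lt_1[of x] unfolding frac_def by linarith
  qed
qed

lemma borel_measurable_frac [measurable]: "frac \<in> borel_measurable (borel :: real measure)"
  unfolding frac_def by measurable

lemma borel_measurable_dist_nearest_int [measurable]: "dist_nearest_int \<in> borel_measurable borel"
  unfolding dist_nearest_int_eq_min by measurable

lemma dist_nearest_int_frac_diff: "dist_nearest_int (x - frac c) = dist_nearest_int (x - c)"
proof -
  have "frac (x - frac c) = frac (x - c)"
    using floor_add_int[of "x - c" "\<lfloor>c\<rfloor>"] by (simp add: frac_def algebra_simps)
  then show ?thesis by (simp add: dist_nearest_int_eq_min)
qed

lemma dist_nearest_int_minus: "dist_nearest_int (- x) = dist_nearest_int x"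
proof -
  have "dist_nearest_int (- x) \<le> dist_nearest_int x" for x
    using dist_nearest_int_attained[of x] dist_nearest_int_le[of "- x" "- k" for k]
    by (metis abs_minus_cancel minus_diff_eq of_int_minus minus_diff_minus)
  from this[of x] this[of "- x"] show ?thesis by simp
qed

text \<open>Rotation invariance of Lebesgue measure on the circle. With \<open>t = frac c\<close>
  the rotation is translation by \<open>t\<close> on \<open>[0, 1 - t)\<close> and by
  \<open>t - 1\<close> on \<open>[1 - t, 1)\<close>.\<close>

lemma nn_integral_frac_shift:
  fixes f :: "real \<Rightarrow> ennreal"
  assumes [measurable]: "f \<in> borel_measurable borel"
  shows "(\<integral>\<^sup>+x. f (frac (x + c)) * indicator {0..<1} x \<partial>lborel) = (\<integral>\<^sup>+x. f x * indicator {0..<1} x \<partial>lborel)"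
proof -
  define t where "t = frac c"
  have t: "0 \<le> t" "t < 1" by (auto simp: t_def frac_lt_1)
  \<comment> \<open>The factors \<open>1 *\<close> match the affine substitution rule applied to
    both pieces.\<close>
  have "(\<integral>\<^sup>+x. f (frac (x + c)) * indicator {0..<1} x \<partial>lborel) =
      (\<integral>\<^sup>+x. f (t + 1 * x) * indicator {t..<1} (t + 1 * x) + f (t - 1 + 1 * x) * indicator {0..<t} (t - 1 + 1 * x) \<partial>lborel)"
  proof (intro nn_integral_cong)
    fix x :: real
    have "frac (x + c) = frac (x + t)"
      unfolding t_def by (simp add: frac_add frac_frac)
    moreover have "frac (x + t) = (if x + t < 1 then x + t else x + t - 1)" if "x \<in> {0..<1}"
      using that t frac_eq[of x] frac_eq[of t] by (simp add: frac_add)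
    ultimately show "f (frac (x + c)) * indicator {0..<1} x =
        f (t + 1 * x) * indicator {t..<1} (t + 1 * x) + f (t - 1 + 1 * x) * indicator {0..<t} (t - 1 + 1 * x)"
      using t by (auto simp: indicator_def add.commute algebra_simps)
  qed
  also have "\<dots> = (\<integral>\<^sup>+x. f (t + 1 * x) * indicator {t..<1} (t + 1 * x) \<partial>lborel)
      + (\<integral>\<^sup>+x. f (t - 1 + 1 * x) * indicator {0..<t} (t - 1 + 1 * x) \<partial>lborel)"
    by (rule nn_integral_add) auto
  also have "\<dots> = (\<integral>\<^sup>+x. f x * indicator {t..<1} x \<partial>lborel) + (\<integral>\<^sup>+x. f x * indicator {0..<t} x \<partial>lborel)"
    using nn_integral_real_affine[of "\<lambda>x. f x * indicator {t..<1} x" 1 t]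
      nn_integral_real_affine[of "\<lambda>x. f x * indicator {0..<t} x" 1 "t - 1"] by simp
  also have "\<dots> = (\<integral>\<^sup>+x. f x * indicator {t..<1} x + f x * indicator {0..<t} x \<partial>lborel)"
    by (rule nn_integral_add[symmetric]) auto
  also have "\<dots> = (\<integral>\<^sup>+x. f x * indicator {0..<1} x \<partial>lborel)"
    using t by (intro nn_integral_cong) (auto simp: indicator_def)
  finally show ?thesis .
qed

text \<open>Rotation invariance, applied to the indicator of a Borel null set that contains the
  exceptional points.\<close>

lemma AE_frac_shift:
  fixes P :: "real \<Rightarrow> bool" and c :: real
  assumes "AE x in lborel. x \<in> {0..<1} \<longrightarrow> P x"
  shows "AE x in lborel. x \<in> {0..<1} \<longrightarrow> P (frac (x + c))"
proof -
  obtain N where N: "{x \<in> space lborel. \<not> (x \<in> {0..<1} \<longrightarrow> P x)} \<subseteq> N" "emeasure lborel N = 0" "N \<in> sets lborel"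
    using AE_E[OF assms] by blast
  have [measurable]: "N \<in> sets borel" using N(3) by simp
  have "(\<integral>\<^sup>+x. indicator N (frac (x + c)) * indicator {0..<1} x \<partial>lborel) =
      (\<integral>\<^sup>+x. indicator N x * indicator {0..<1} x \<partial>lborel)"
    by (rule nn_integral_frac_shift) measurable
  also have "\<dots> \<le> (\<integral>\<^sup>+x. indicator N x \<partial>lborel)"
    by (intro nn_integral_mono) (auto simp: indicator_def)
  also have "\<dots> = 0" using N by simp
  finally have "(\<integral>\<^sup>+x. indicator N (frac (x + c)) * indicator {0..<1} x \<partial>lborel) = (0::ennreal)" by simp
  then have "AE x in lborel. indicator N (frac (x + c)) * indicator {0..<1} x = (0::ennreal)"
    by (subst (asm) nn_integral_0_iff_AE) auto
  then show ?thesis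
  proof eventually_elim
    case (elim x)
    show ?case
    proof
      assume "x \<in> {0..<1}"
      with elim have "frac (x + c) \<notin> N" by (auto simp: indicator_def split: if_splits)
      moreover have "frac (x + c) \<in> {0..<1}" "frac (x + c) \<in> space lborel"
        by (auto simp: frac_lt_1)
      ultimately show "P (frac (x + c))" using N(1) by blast
    qed
  qed
qed

text \<open>After rotating \<open>c\<close> to 0 the arc lies in
  \<open>{0..\<epsilon>} \<union> {1 - \<epsilon>..1}\<close>. As an upper bound this also covers
  large \<open>\<epsilon>\<close>, where the two pieces overlap.\<close>

lemma emeasure_dist_nearest_int_le:
  assumes "0 \<le> \<epsilon>"
  shows "emeasure lborel {y \<in> {0..<1}. dist_nearest_int (y - c) \<le> \<epsilon>} \<le> ennreal (2 * \<epsilon>)"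
proof -
  have "emeasure lborel {y \<in> {0..<1}. dist_nearest_int (y - c) \<le> \<epsilon>} =
      (\<integral>\<^sup>+y. indicator {y \<in> {0..<1}. dist_nearest_int (y - c) \<le> \<epsilon>} y \<partial>lborel)"
    by (rule nn_integral_indicator[symmetric]) measurable
  also have "\<dots> = (\<integral>\<^sup>+y. indicator {y. dist_nearest_int y \<le> \<epsilon>} (frac (y + (- c))) * indicator {0..<1} y \<partial>lborel)"
    by (intro nn_integral_cong) (auto simp: indicator_def dist_nearest_int_eq_min frac_frac)
  also have "\<dots> = (\<integral>\<^sup>+y. indicator {y. dist_nearest_int y \<le> \<epsilon>} y * indicator {0..<1} y \<partial>lborel)"
    by (rule nn_integral_frac_shift) measurable
  also have "\<dots> \<le> (\<integral>\<^sup>+y. indicator {0..\<epsilon>} y + indicator {1 - \<epsilon>..1} y \<partial>lborel)"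
    by (intro nn_integral_mono) (auto simp: indicator_def dist_nearest_int_eq_min frac_eq[THEN iffD2] min_def split: if_splits)
  also have "\<dots> = ennreal \<epsilon> + ennreal \<epsilon>"
    using assms by (subst nn_integral_add) auto
  finally show ?thesis using assms by (simp flip: ennreal_plus)
qed

section \<open>Weak convergence in $L^2$\<close>

lemma integrable_mult_of_square_integrable:
  fixes f g :: "'a \<Rightarrow> real"
  assumes [measurable]: "f \<in> borel_measurable M" "g \<in> borel_measurable M"
    and "integrable M (\<lambda>x. (f x)\<^sup>2)" "integrable M (\<lambda>x. (g x)\<^sup>2)"
  shows "integrable M (\<lambda>x. f x * g x)"
proof (rule Bochner_Integration.integrable_bound)
  show "integrable M (\<lambda>x. (f x)\<^sup>2 + (g x)\<^sup>2)" using assms by auto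
  show "AE x in M. norm (f x * g x) \<le> norm ((f x)\<^sup>2 + (g x)\<^sup>2)"
  proof (intro AE_I2)
    fix x
    have "0 \<le> (\<bar>f x\<bar> - \<bar>g x\<bar>)\<^sup>2" by simp
    then have "2 * (\<bar>f x\<bar> * \<bar>g x\<bar>) \<le> (f x)\<^sup>2 + (g x)\<^sup>2" by (simp add: power2_diff algebra_simps)
    moreover have "0 \<le> \<bar>f x\<bar> * \<bar>g x\<bar>" by (intro mult_nonneg_nonneg) auto
    ultimately show "norm (f x * g x) \<le> norm ((f x)\<^sup>2 + (g x)\<^sup>2)"
      unfolding real_norm_def abs_mult by linarith
  qed
qed auto

text \<open>The integral of \<open>(f + t * g)^2\<close>, a polynomial of degree at most two in
  \<open>t\<close>, is nonnegative for every \<open>t\<close>.\<close>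

lemma integral_Cauchy_Schwarz:
  fixes f g :: "'a \<Rightarrow> real"
  assumes [measurable]: "f \<in> borel_measurable M" "g \<in> borel_measurable M"
    and f: "integrable M (\<lambda>x. (f x)\<^sup>2)" and g: "integrable M (\<lambda>x. (g x)\<^sup>2)"
  shows "(\<integral>x. f x * g x \<partial>M)\<^sup>2 \<le> (\<integral>x. (f x)\<^sup>2 \<partial>M) * (\<integral>x. (g x)\<^sup>2 \<partial>M)"
proof -
  define a b c where "a = (\<integral>x. (f x)\<^sup>2 \<partial>M)" and "b = (\<integral>x. f x * g x \<partial>M)" and "c = (\<integral>x. (g x)\<^sup>2 \<partial>M)"
  note fg = integrable_mult_of_square_integrable[OF assms]
  have pos: "0 \<le> a + 2 * t * b + t\<^sup>2 * c" for t
  proof -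
    have "0 \<le> (\<integral>x. (f x + t * g x)\<^sup>2 \<partial>M)" by simp
    also have "(\<lambda>x. (f x + t * g x)\<^sup>2) = (\<lambda>x. (f x)\<^sup>2 + 2 * t * (f x * g x) + t\<^sup>2 * (g x)\<^sup>2)"
      by (auto simp: power2_eq_square algebra_simps)
    also have "(\<integral>x. (f x)\<^sup>2 + 2 * t * (f x * g x) + t\<^sup>2 * (g x)\<^sup>2 \<partial>M) = a + 2 * t * b + t\<^sup>2 * c"
      unfolding a_def b_def c_def using f g fg by simp
    finally show ?thesis .
  qed
  have "0 \<le> c" by (simp add: c_def)
  show ?thesis
  proof (cases "c = 0")
    case True
    have "b = 0"
    proof (rule ccontr)
      assume "b \<noteq> 0"
      \<comment> \<open>With \<open>c = 0\<close> the polynomial is affine, and at this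
        \<open>t\<close> it takes the value -1.\<close>
      with pos[of "- (a + 1) / (2 * b)"] True show False by (simp add: field_simps)
    qed
    then show ?thesis using True by (simp add: a_def b_def c_def)
  next
    case False
    then have "c > 0" using \<open>0 \<le> c\<close> by simp
    \<comment> \<open>The point \<open>- b / c\<close> minimises the quadratic.\<close>
    have "a + 2 * (- b / c) * b + (- b / c)\<^sup>2 * c = a - b\<^sup>2 / c"
      using False by (simp add: power2_eq_square field_simps)
    with pos[of "- b / c"] have "b\<^sup>2 / c \<le> a" by simp
    then show ?thesis using \<open>c > 0\<close> by (simp add: a_def b_def c_def field_simps)
  qed
qed

text \<open>Fatou's lemma as an eventual lower bound on real integrals. A negative threshold is
  treated apart, because \<open>ennreal\<close> truncates it to 0.\<close>

lemma eventually_integral_gt_of_AE_tendsto: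
  fixes h :: "nat \<Rightarrow> 'a \<Rightarrow> real"
  assumes "\<And>n. integrable M (h n)" "\<And>n x. 0 \<le> h n x" "integrable M f" "\<And>x. 0 \<le> f x"
    and lim: "AE x in M. (\<lambda>n. h n x) \<longlonglongrightarrow> f x" and "e > 0"
  shows "eventually (\<lambda>n. (\<integral>x. h n x \<partial>M) > (\<integral>x. f x \<partial>M) - e) sequentially"
proof (cases "(\<integral>x. f x \<partial>M) - e < 0")
  case True
  then show ?thesis
    using assms(2) by (intro always_eventually allI less_le_trans[OF True]) auto
next
  case False
  have "ennreal ((\<integral>x. f x \<partial>M) - e) < ennreal (\<integral>x. f x \<partial>M)"
    using False \<open>e > 0\<close> by (intro ennreal_lessI) auto
  also have "\<dots> = (\<integral>\<^sup>+x. ennreal (f x) \<partial>M)"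
    using assms by (intro nn_integral_eq_integral[symmetric]) auto
  also have "\<dots> = (\<integral>\<^sup>+x. liminf (\<lambda>n. ennreal (h n x)) \<partial>M)"
    using lim by (intro nn_integral_cong_AE, eventually_elim)
      (auto intro!: lim_imp_Liminf[symmetric] tendsto_ennrealI)
  also have "\<dots> \<le> liminf (\<lambda>n. \<integral>\<^sup>+x. ennreal (h n x) \<partial>M)"
    using assms(1) by (intro nn_integral_liminf) auto
  also have "(\<lambda>n. \<integral>\<^sup>+x. ennreal (h n x) \<partial>M) = (\<lambda>n. ennreal (\<integral>x. h n x \<partial>M))"
    using assms by (intro ext nn_integral_eq_integral) auto
  finally have "eventually (\<lambda>n. ennreal ((\<integral>x. f x \<partial>M) - e) < ennreal (\<integral>x. h n x \<partial>M)) sequentially"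
    by (rule less_LiminfD)
  then show ?thesis
    by eventually_elim (use False in \<open>auto simp: ennreal_less_iff\<close>)
qed

text \<open>
  The norm bound turns Fatou's lemma for \<open>(u + F n)\<^sup>2\<close> into a one-sided estimate of the cross term;
  replacing \<open>u\<close> by \<open>- u\<close> gives the other side.
\<close>
lemma integral_mult_tendsto_of_AE_tendsto:
  fixes u f :: "'a \<Rightarrow> real" and F :: "nat \<Rightarrow> 'a \<Rightarrow> real"
  assumes [measurable]: "u \<in> borel_measurable M" "f \<in> borel_measurable M" "\<And>n. F n \<in> borel_measurable M"
    and u: "integrable M (\<lambda>x. (u x)\<^sup>2)" and f: "integrable M (\<lambda>x. (f x)\<^sup>2)"
    and F: "\<And>n. integrable M (\<lambda>x. (F n x)\<^sup>2)"
    and le: "\<And>n. (\<integral>x. (F n x)\<^sup>2 \<partial>M) \<le> (\<integral>x. (f x)\<^sup>2 \<partial>M)"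
    and lim: "AE x in M. (\<lambda>n. F n x) \<longlonglongrightarrow> f x"
  shows "(\<lambda>n. \<integral>x. u x * F n x \<partial>M) \<longlonglongrightarrow> (\<integral>x. u x * f x \<partial>M)"
proof -
  have lower: "eventually (\<lambda>n. (\<integral>x. v x * F n x \<partial>M) > (\<integral>x. v x * f x \<partial>M) - e) sequentially"
    if [measurable]: "v \<in> borel_measurable M" and v: "integrable M (\<lambda>x. (v x)\<^sup>2)" and "e > 0" for v e
  proof -
    have expand: "integrable M (\<lambda>x. (v x + k x)\<^sup>2)"
       "(\<integral>x. (v x + k x)\<^sup>2 \<partial>M) = (\<integral>x. (v x)\<^sup>2 \<partial>M) + 2 * (\<integral>x. v x * k x \<partial>M) + (\<integral>x. (k x)\<^sup>2 \<partial>M)"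
      if [measurable]: "k \<in> borel_measurable M" and k: "integrable M (\<lambda>x. (k x)\<^sup>2)" for k
    proof -
      have vk: "integrable M (\<lambda>x. v x * k x)"
        by (rule integrable_mult_of_square_integrable) (use v k in auto)
      have eq: "(\<lambda>x. (v x + k x)\<^sup>2) = (\<lambda>x. (v x)\<^sup>2 + 2 * (v x * k x) + (k x)\<^sup>2)"
        by (auto simp: power2_eq_square algebra_simps)
      show "integrable M (\<lambda>x. (v x + k x)\<^sup>2)"
        unfolding eq using v k vk by auto
      show "(\<integral>x. (v x + k x)\<^sup>2 \<partial>M) = (\<integral>x. (v x)\<^sup>2 \<partial>M) + 2 * (\<integral>x. v x * k x \<partial>M) + (\<integral>x. (k x)\<^sup>2 \<partial>M)"
        unfolding eq using v k vk by simp
    qed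
    have "eventually (\<lambda>n. (\<integral>x. (v x + F n x)\<^sup>2 \<partial>M) > (\<integral>x. (v x + f x)\<^sup>2 \<partial>M) - 2 * e) sequentially"
    proof (rule eventually_integral_gt_of_AE_tendsto)
      show "AE x in M. (\<lambda>n. (v x + F n x)\<^sup>2) \<longlonglongrightarrow> (v x + f x)\<^sup>2"
        using lim by eventually_elim (auto intro!: tendsto_intros)
    qed (use expand(1) f F \<open>e > 0\<close> in auto)
    then show ?thesis
    proof eventually_elim
      case (elim n)
      then show ?case
        using expand(2)[of f] expand(2)[of "F n"] f F le[of n] by (simp add: algebra_simps)
    qed
  qed
  show ?thesis
  proof (rule tendstoI)
    fix e :: real assume "e > 0"
    have "eventually (\<lambda>n. (\<integral>x. u x * F n x \<partial>M) > (\<integral>x. u x * f x \<partial>M) - e) sequentially"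
      using u \<open>e > 0\<close> by (intro lower) auto
    moreover have "eventually (\<lambda>n. (\<integral>x. - u x * F n x \<partial>M) > (\<integral>x. - u x * f x \<partial>M) - e) sequentially"
      using u \<open>e > 0\<close> by (intro lower) auto
    ultimately show "eventually (\<lambda>n. dist (\<integral>x. u x * F n x \<partial>M) (\<integral>x. u x * f x \<partial>M) < e) sequentially"
      by eventually_elim (auto simp: dist_real_def abs_if)
  qed
qed

section \<open>Short arcs under a square-integrable density\<close>

text \<open>\<open>{0..<1}\<close> is a fundamental domain of the circle: for a density vanishing
  outside it, \<open>g (frac x)\<close> is the periodic extension, and integrals over the line and
  over the unit interval agree.\<close>

locale l2_density =
  fixes g :: "real \<Rightarrow> real"
  assumes g_borel [measurable]: "g \<in> borel_measurable borel"
    and g_nonneg: "\<And>x. 0 \<le> g x"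
    and g_zero: "\<And>x. x \<notin> {0..<1} \<Longrightarrow> g x = 0"
    and g_square: "integrable lborel (\<lambda>x. (g x)\<^sup>2)"
    and g_prob: "prob_space (density lborel (\<lambda>x. ennreal (g x)))"
begin

definition \<mu> :: "real measure" where "\<mu> = density lborel (\<lambda>x. ennreal (g x))"

definition K :: real where "K = (\<integral>x. (g x)\<^sup>2 \<partial>lborel)"

definition arc :: "real \<Rightarrow> real \<Rightarrow> real" where
  "arc \<epsilon> c = measure \<mu> {x. dist_nearest_int (x - c) \<le> \<epsilon>}"

text \<open>For independent \<open>U\<close> and \<open>V\<close> with law \<open>\<mu>\<close> this
  is the probability that \<open>U - V - \<gamma>\<close> is within \<open>\<epsilon>\<close> of an
  integer, computed by conditioning on \<open>V = y\<close>.\<close>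

definition pair_prob :: "real \<Rightarrow> real \<Rightarrow> real" where
  "pair_prob \<gamma> \<epsilon> = (\<integral>y. arc \<epsilon> (y + \<gamma>) \<partial>\<mu>)"

sublocale \<mu>: prob_space \<mu>
  unfolding \<mu>_def by (rule g_prob)

lemma sets_\<mu> [simp, measurable_cong]: "sets \<mu> = sets borel"
  by (simp add: \<mu>_def)

lemma space_\<mu> [simp]: "space \<mu> = UNIV"
  by (simp add: \<mu>_def)

lemma K_nonneg: "0 \<le> K"
  by (simp add: K_def)

lemma nn_integral_g_square: "(\<integral>\<^sup>+x. ennreal ((g x)\<^sup>2) \<partial>lborel) = ennreal K"
  unfolding K_def by (rule nn_integral_eq_integral[OF g_square]) simp

lemma measure_\<mu>_eq_integral:
  assumes [measurable]: "S \<in> sets borel"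
  shows "measure \<mu> S = (\<integral>x. g x * indicator S x \<partial>lborel)"
proof -
  have "measure \<mu> S = (\<integral>x. indicator S x \<partial>\<mu>)" by simp
  also have "\<dots> = (\<integral>x. g x * indicator S x \<partial>lborel)"
    unfolding \<mu>_def by (subst integral_real_density) (auto simp: g_nonneg)
  finally show ?thesis .
qed

lemma borel_measurable_arc [measurable]: "arc \<epsilon> \<in> borel_measurable borel"
proof -
  have "arc \<epsilon> c = (\<integral>x. indicator {x. dist_nearest_int (x - c) \<le> \<epsilon>} x \<partial>\<mu>)" for c
    by (simp add: arc_def)
  then have "arc \<epsilon> = (\<lambda>c. \<integral>x. (if dist_nearest_int (x - c) \<le> \<epsilon> then 1 else 0) \<partial>\<mu>)"
    by (simp add: indicator_def of_bool_def fun_eq_iff)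
  moreover have "(\<lambda>c. \<integral>x. (if dist_nearest_int (x - c) \<le> \<epsilon> then 1 else 0 :: real) \<partial>\<mu>) \<in> borel_measurable borel"
    by (rule \<mu>.borel_measurable_lebesgue_integral) measurable
  ultimately show ?thesis by simp
qed

lemma arc_nonneg: "0 \<le> arc \<epsilon> c" and arc_le_1: "arc \<epsilon> c \<le> 1"
  by (auto simp: arc_def)

lemma integrable_g_square_mult_indicator:
  assumes [measurable]: "S \<in> sets borel"
  shows "integrable lborel (\<lambda>x. (g x)\<^sup>2 * indicator S x)"
  by (rule Bochner_Integration.integrable_bound[OF g_square]) (auto simp: indicator_def)

text \<open>Cauchy-Schwarz for \<open>g\<close> on the arc against the indicator of the arc. The
  integral of \<open>g^2\<close> stays localised, since it is later integrated over the centre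
  \<open>c\<close>.\<close>

lemma arc_square_le:
  assumes "0 \<le> \<epsilon>"
  shows "(arc \<epsilon> c)\<^sup>2 \<le> 2 * \<epsilon> * (\<integral>x. (g x)\<^sup>2 * indicator {x. dist_nearest_int (x - c) \<le> \<epsilon>} x \<partial>lborel)"
proof -
  define S where "S = {x. dist_nearest_int (x - c) \<le> \<epsilon>}"
  \<comment> \<open>\<open>S\<close> is a periodic subset of the line. Its part in the unit interval
    has finite measure and carries all the mass that \<open>g\<close> has on
    \<open>S\<close>.\<close>
  define T where "T = {y \<in> {0..<1}. dist_nearest_int (y - c) \<le> \<epsilon>}"
  have [measurable]: "S \<in> sets borel" "T \<in> sets borel" unfolding S_def T_def by measurable
  have T_le: "emeasure lborel T \<le> ennreal (2 * \<epsilon>)"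
    unfolding T_def by (rule emeasure_dist_nearest_int_le[OF assms])
  then have T_fin: "emeasure lborel T < \<infinity>"
    using le_less_trans by fastforce
  have T_meas: "measure lborel T \<le> 2 * \<epsilon>"
    using T_le assms by (simp add: measure_def enn2real_leI)
  have sq: "((indicator A x :: real))\<^sup>2 = indicator A x" for A and x :: real
    by (simp add: indicator_def)
  have "arc \<epsilon> c = (\<integral>x. (g x * indicator S x) * indicator T x \<partial>lborel)"
    unfolding arc_def S_def[symmetric] measure_\<mu>_eq_integral[OF \<open>S \<in> sets borel\<close>]
    by (intro Bochner_Integration.integral_cong) (auto simp: indicator_def S_def T_def intro: g_zero)
  then have "(arc \<epsilon> c)\<^sup>2 \<le> (\<integral>x. (g x * indicator S x)\<^sup>2 \<partial>lborel) * (\<integral>x. (indicator T x :: real)\<^sup>2 \<partial>lborel)"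
    using integrable_g_square_mult_indicator[of S] T_fin
    by (simp only:, intro integral_Cauchy_Schwarz) (auto simp: power_mult_distrib sq)
  also have "\<dots> = (\<integral>x. (g x)\<^sup>2 * indicator S x \<partial>lborel) * measure lborel T"
    by (simp add: power_mult_distrib sq)
  also have "\<dots> \<le> (\<integral>x. (g x)\<^sup>2 * indicator S x \<partial>lborel) * (2 * \<epsilon>)"
    using T_meas by (intro mult_left_mono) auto
  finally show ?thesis by (simp add: S_def mult.commute)
qed

lemma arc_le_sqrt:
  assumes "0 \<le> \<epsilon>"
  shows "arc \<epsilon> c \<le> sqrt (2 * \<epsilon> * K)"
proof (rule real_le_rsqrt)
  have [measurable]: "{x. dist_nearest_int (x - c) \<le> \<epsilon>} \<in> sets borel" by measurable
  have "(\<integral>x. (g x)\<^sup>2 * indicator {x. dist_nearest_int (x - c) \<le> \<epsilon>} x \<partial>lborel) \<le> K"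
    unfolding K_def
    by (intro integral_mono integrable_g_square_mult_indicator g_square) (auto simp: indicator_def)
  with arc_square_le[OF assms, of c] assms show "(arc \<epsilon> c)\<^sup>2 \<le> 2 * \<epsilon> * K"
    by (meson mult_left_mono order_trans mult_nonneg_nonneg zero_le_numeral)
qed

text \<open>The local bound is integrated over the centre and the order of integration swapped: each
  \<open>x\<close> is within \<open>\<epsilon>\<close> of centres of measure at most
  \<open>2 * \<epsilon>\<close>, which supplies a second such factor. Hence the quotients of
  \<open>arc\<close> by \<open>2 * \<epsilon>\<close> have squared norm at most
  \<open>K\<close>.\<close>

lemma nn_integral_arc_square_le:
  assumes "0 \<le> \<epsilon>"
  shows "(\<integral>\<^sup>+y. ennreal ((arc \<epsilon> (y + \<gamma>))\<^sup>2) * indicator {0..<1} y \<partial>lborel) \<le> ennreal (4 * \<epsilon>\<^sup>2 * K)"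
proof -
  let ?I = "\<lambda>x y. indicator {y \<in> {0..<1}. dist_nearest_int (y - (x - \<gamma>)) \<le> \<epsilon>} y :: ennreal"
  have "(\<integral>\<^sup>+y. ennreal ((arc \<epsilon> (y + \<gamma>))\<^sup>2) * indicator {0..<1} y \<partial>lborel) \<le>
      (\<integral>\<^sup>+y. (\<integral>\<^sup>+x. ennreal (2 * \<epsilon>) * (ennreal ((g x)\<^sup>2) * ?I x y) \<partial>lborel) \<partial>lborel)"
  proof (rule nn_integral_mono)
    fix y :: real
    \<comment> \<open>Evenness of the distance turns the condition on \<open>x\<close> into an arc
      in \<open>y\<close> about \<open>x - \<gamma>\<close>, whose measure is bounded after the
      swap.\<close>
    have eq: "dist_nearest_int (y - (x - \<gamma>)) = dist_nearest_int (x - (y + \<gamma>))" for x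
      using dist_nearest_int_minus[of "x - (y + \<gamma>)"] by (simp add: algebra_simps)
    have [measurable]: "{x. dist_nearest_int (x - (y + \<gamma>)) \<le> \<epsilon>} \<in> sets borel" by measurable
    show "ennreal ((arc \<epsilon> (y + \<gamma>))\<^sup>2) * indicator {0..<1} y \<le>
        (\<integral>\<^sup>+x. ennreal (2 * \<epsilon>) * (ennreal ((g x)\<^sup>2) * ?I x y) \<partial>lborel)"
    proof (cases "y \<in> {0..<1}")
      case True
      have "ennreal ((arc \<epsilon> (y + \<gamma>))\<^sup>2) \<le> ennreal (2 * \<epsilon>) *
          ennreal (\<integral>x. (g x)\<^sup>2 * indicator {x. dist_nearest_int (x - (y + \<gamma>)) \<le> \<epsilon>} x \<partial>lborel)"
        using arc_square_le[OF assms, of "y + \<gamma>"] assms by (simp flip: ennreal_mult add: ennreal_leI)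
      also have "\<dots> = ennreal (2 * \<epsilon>) *
          (\<integral>\<^sup>+x. ennreal ((g x)\<^sup>2 * indicator {x. dist_nearest_int (x - (y + \<gamma>)) \<le> \<epsilon>} x) \<partial>lborel)"
        by (subst nn_integral_eq_integral) (auto intro!: integrable_g_square_mult_indicator)
      also have "\<dots> = (\<integral>\<^sup>+x. ennreal (2 * \<epsilon>) * (ennreal ((g x)\<^sup>2) * ?I x y) \<partial>lborel)"
        using True by (subst nn_integral_cmult[symmetric])
          (auto intro!: nn_integral_cong simp: eq indicator_def)
      finally show ?thesis using True by simp
    qed simp
  qed
  also have "\<dots> = (\<integral>\<^sup>+x. (\<integral>\<^sup>+y. ennreal (2 * \<epsilon>) * (ennreal ((g x)\<^sup>2) * ?I x y) \<partial>lborel) \<partial>lborel)"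
    by (rule lborel_pair.Fubini') (simp add: indicator_def, measurable)
  also have "\<dots> = (\<integral>\<^sup>+x. ennreal (2 * \<epsilon>) * (ennreal ((g x)\<^sup>2) *
      emeasure lborel {y \<in> {0..<1}. dist_nearest_int (y - (x - \<gamma>)) \<le> \<epsilon>}) \<partial>lborel)"
    by (intro nn_integral_cong) (simp add: nn_integral_cmult)
  also have "\<dots> \<le> (\<integral>\<^sup>+x. ennreal (2 * \<epsilon>) * (ennreal ((g x)\<^sup>2) * ennreal (2 * \<epsilon>)) \<partial>lborel)"
    by (intro nn_integral_mono mult_left_mono emeasure_dist_nearest_int_le[OF assms]) auto
  also have "\<dots> = (\<integral>\<^sup>+x. ennreal (4 * \<epsilon>\<^sup>2) * ennreal ((g x)\<^sup>2) \<partial>lborel)"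
    using assms by (intro nn_integral_cong) (simp flip: ennreal_mult add: power2_eq_square mult_ac)
  also have "\<dots> = ennreal (4 * \<epsilon>\<^sup>2 * K)"
    using K_nonneg by (simp add: nn_integral_cmult nn_integral_g_square ennreal_mult)
  finally show ?thesis .
qed

section \<open>Arc quotients as square-integrable functions on the unit interval\<close>

abbreviation leb01 :: "real measure" where "leb01 \<equiv> restrict_space lborel {0..<1}"

lemma integrable_arc_square: "integrable leb01 (\<lambda>y. (arc \<epsilon> (y + \<gamma>))\<^sup>2)"
proof (rule finite_measure.integrable_const_bound[where B=1])
  show "finite_measure leb01"
    by (intro finite_measureI) (simp add: emeasure_restrict_space space_restrict_space)
  show "AE y in leb01. norm ((arc \<epsilon> (y + \<gamma>))\<^sup>2) \<le> 1"
    using arc_nonneg arc_le_1 by (intro AE_I2) (simp add: power_le_one)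
  show "(\<lambda>y. (arc \<epsilon> (y + \<gamma>))\<^sup>2) \<in> borel_measurable leb01"
    by (intro measurable_restrict_space1) measurable
qed

lemma integral_arc_square_le:
  assumes "0 \<le> \<epsilon>"
  shows "(\<integral>y. (arc \<epsilon> (y + \<gamma>))\<^sup>2 \<partial>leb01) \<le> 4 * \<epsilon>\<^sup>2 * K"
proof -
  have "ennreal (\<integral>y. (arc \<epsilon> (y + \<gamma>))\<^sup>2 \<partial>leb01) = (\<integral>\<^sup>+y. ennreal ((arc \<epsilon> (y + \<gamma>))\<^sup>2) \<partial>leb01)"
    by (rule nn_integral_eq_integral[symmetric]) (auto intro: integrable_arc_square)
  also have "\<dots> \<le> ennreal (4 * \<epsilon>\<^sup>2 * K)"
    using nn_integral_arc_square_le[OF assms, of \<gamma>] by (simp add: nn_integral_restrict_space)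
  finally show ?thesis using K_nonneg by (simp add: ennreal_le_iff)
qed

lemma integral_unit_eq:
  assumes "\<And>x. x \<notin> {0..<1} \<Longrightarrow> f x = (0::real)"
  shows "(\<integral>x. f x \<partial>leb01) = (\<integral>x. f x \<partial>lborel)"
  using assms by (subst integral_restrict_space) (force intro!: Bochner_Integration.integral_cong simp: indicator_def)+

lemma integrable_g_square_unit: "integrable leb01 (\<lambda>x. (g x)\<^sup>2)"
  using integrable_g_square_mult_indicator[of "{0..<1}"]
  by (subst integrable_restrict_space) (auto simp: mult.commute)

lemma g_unit [measurable]: "g \<in> borel_measurable leb01"
  by (intro measurable_restrict_space1) measurable

lemma pair_prob_eq: "pair_prob \<gamma> \<epsilon> = (\<integral>y. g y * arc \<epsilon> (y + \<gamma>) \<partial>leb01)"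
proof -
  have "pair_prob \<gamma> \<epsilon> = (\<integral>y. g y * arc \<epsilon> (y + \<gamma>) \<partial>lborel)"
    unfolding pair_prob_def \<mu>_def by (subst integral_real_density) (auto simp: g_nonneg)
  also have "\<dots> = (\<integral>y. g y * arc \<epsilon> (y + \<gamma>) \<partial>leb01)"
    by (rule integral_unit_eq[symmetric]) (simp add: g_zero)
  finally show ?thesis .
qed

text \<open>Cauchy-Schwarz for \<open>g\<close> against the arc probabilities. The bound is linear
  in \<open>\<epsilon>\<close>, whereas the pointwise bound on \<open>arc\<close> gives only a
  square root.\<close>

lemma pair_prob_le:
  assumes "0 \<le> \<epsilon>"
  shows "pair_prob \<gamma> \<epsilon> \<le> 2 * \<epsilon> * K"
proof -
  have "(pair_prob \<gamma> \<epsilon>)\<^sup>2 \<le> (\<integral>y. (g y)\<^sup>2 \<partial>leb01) * (\<integral>y. (arc \<epsilon> (y + \<gamma>))\<^sup>2 \<partial>leb01)"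
    unfolding pair_prob_eq
    by (intro integral_Cauchy_Schwarz integrable_g_square_unit integrable_arc_square)
      (auto intro: measurable_restrict_space1)
  also have "\<dots> = K * (\<integral>y. (arc \<epsilon> (y + \<gamma>))\<^sup>2 \<partial>leb01)"
    unfolding K_def by (subst integral_unit_eq) (auto simp: g_zero)
  also have "\<dots> \<le> K * (4 * \<epsilon>\<^sup>2 * K)"
    by (intro mult_left_mono integral_arc_square_le assms K_nonneg)
  also have "\<dots> = (2 * \<epsilon> * K)\<^sup>2" by (simp add: power2_eq_square)
  finally show ?thesis
    using assms K_nonneg by (rule_tac power2_le_imp_le) auto
qed

text \<open>By rotation invariance \<open>K\<close> is also the squared norm of the weak limit,
  which is the bound that weak convergence asks of the quotients.\<close>

lemma integral_frac_shift_g_square: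
  "integrable leb01 (\<lambda>y. (g (frac (y + \<gamma>)))\<^sup>2)"
  "(\<integral>y. (g (frac (y + \<gamma>)))\<^sup>2 \<partial>leb01) = K"
proof -
  have "(\<integral>\<^sup>+y. ennreal ((g (frac (y + \<gamma>)))\<^sup>2) \<partial>leb01) = (\<integral>\<^sup>+y. ennreal ((g (frac (y + \<gamma>)))\<^sup>2) * indicator {0..<1} y \<partial>lborel)"
    by (simp add: nn_integral_restrict_space)
  also have "\<dots> = (\<integral>\<^sup>+y. ennreal ((g y)\<^sup>2) * indicator {0..<1} y \<partial>lborel)"
    by (rule nn_integral_frac_shift) measurable
  also have "\<dots> = (\<integral>\<^sup>+y. ennreal ((g y)\<^sup>2) \<partial>lborel)"
    by (intro nn_integral_cong) (auto simp: indicator_def g_zero)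
  finally have eq: "(\<integral>\<^sup>+y. ennreal ((g (frac (y + \<gamma>)))\<^sup>2) \<partial>leb01) = ennreal K"
    by (simp add: nn_integral_g_square)
  have [measurable]: "(\<lambda>y. (g (frac (y + \<gamma>)))\<^sup>2) \<in> borel_measurable leb01"
    by (intro measurable_restrict_space1) measurable
  show "integrable leb01 (\<lambda>y. (g (frac (y + \<gamma>)))\<^sup>2)"
    by (rule integrableI_nonneg) (auto simp: eq)
  show "(\<integral>y. (g (frac (y + \<gamma>)))\<^sup>2 \<partial>leb01) = K"
    by (rule integral_eq_nn_integral[THEN trans]) (auto simp: eq K_nonneg)
qed

text \<open>Weak convergence of the arc quotients to the rotated density, tested against
  \<open>g\<close>.\<close>

lemma pair_prob_asymp:
  assumes diff: "AE t in lborel. t \<in> {0..<1} \<longrightarrow> ((\<lambda>\<epsilon>. arc \<epsilon> t / (2 * \<epsilon>)) \<longlongrightarrow> g t) (at_right 0)"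
    and \<epsilon>: "\<And>n. 0 < \<epsilon> n" "\<epsilon> \<longlonglongrightarrow> 0"
  shows "(\<lambda>n. pair_prob \<gamma> (\<epsilon> n) / (2 * \<epsilon> n)) \<longlonglongrightarrow> (\<integral>y. g y * g (frac (y + \<gamma>)) \<partial>leb01)"
proof -
  have "(\<lambda>n. \<integral>y. g y * (arc (\<epsilon> n) (y + \<gamma>) / (2 * \<epsilon> n)) \<partial>leb01) \<longlonglongrightarrow> (\<integral>y. g y * g (frac (y + \<gamma>)) \<partial>leb01)"
  proof (rule integral_mult_tendsto_of_AE_tendsto)
    show "(\<lambda>y. g (frac (y + \<gamma>))) \<in> borel_measurable leb01"
      "(\<lambda>y. arc (\<epsilon> n) (y + \<gamma>) / (2 * \<epsilon> n)) \<in> borel_measurable leb01" for n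
      by (intro measurable_restrict_space1, measurable)+
    show "integrable leb01 (\<lambda>y. (arc (\<epsilon> n) (y + \<gamma>) / (2 * \<epsilon> n))\<^sup>2)" for n
      using integrable_arc_square[of "\<epsilon> n" \<gamma>] by (simp add: power_divide)
    have "(\<integral>y. (arc (\<epsilon> n) (y + \<gamma>) / (2 * \<epsilon> n))\<^sup>2 \<partial>leb01) \<le> K" for n
      using integral_arc_square_le[of "\<epsilon> n" \<gamma>] \<epsilon>(1)[of n]
      by (simp add: power_divide power_mult_distrib field_simps)
    then show "(\<integral>y. (arc (\<epsilon> n) (y + \<gamma>) / (2 * \<epsilon> n))\<^sup>2 \<partial>leb01) \<le> (\<integral>y. (g (frac (y + \<gamma>)))\<^sup>2 \<partial>leb01)" for n
      by (simp add: integral_frac_shift_g_square(2))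
    have lim: "filterlim \<epsilon> (at_right 0) sequentially"
      using \<epsilon> by (auto intro!: tendsto_imp_filterlim_at_right)
    have "AE t in lborel. t \<in> {0..<1} \<longrightarrow> (\<lambda>n. arc (\<epsilon> n) t / (2 * \<epsilon> n)) \<longlonglongrightarrow> g t"
      using diff
    proof eventually_elim
      case (elim t)
      then show ?case
        using filterlim_compose[of "\<lambda>e. arc e t / (2 * e)" "nhds (g t)" "at_right 0" \<epsilon> sequentially] lim by simp
    qed
    \<comment> \<open>The hypothesis is moved from \<open>t\<close> to
      \<open>frac (y + \<gamma>)\<close>; an arc depends on its centre only modulo 1.\<close>
    from AE_frac_shift[OF this, of \<gamma>]
    show "AE y in leb01. (\<lambda>n. arc (\<epsilon> n) (y + \<gamma>) / (2 * \<epsilon> n)) \<longlonglongrightarrow> g (frac (y + \<gamma>))"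
      by (simp add: AE_restrict_space_iff arc_def dist_nearest_int_frac_diff)
  qed (auto intro: integrable_g_square_unit integral_frac_shift_g_square)
  then show ?thesis by (simp add: pair_prob_eq)
qed

end

section \<open>Reduction to fourth powers\<close>

definition off_diag :: "nat \<Rightarrow> (nat \<times> nat) set" where
  "off_diag N = {p \<in> {1..N} \<times> {1..N}. fst p \<noteq> snd p}"

lemma finite_off_diag [simp]: "finite (off_diag N)"
  unfolding off_diag_def by simp

lemma card_off_diag: "real (card (off_diag N)) = real N * (real N - 1)"
proof -
  have "off_diag N = {1..N} \<times> {1..N} - (\<lambda>n. (n, n)) ` {1..N}"
    by (auto simp: off_diag_def)
  moreover have "card ((\<lambda>n. (n, n)) ` {1..N}) = N"
    by (subst card_image) (auto simp: inj_on_def)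
  ultimately have "card (off_diag N) = N * N - N"
    using card_Diff_subset[of "(\<lambda>n. (n, n)) ` {1..N}" "{1..N} \<times> {1..N}"]
    by (auto simp: card_cartesian_product)
  then show ?thesis by (cases "N = 0") (auto simp: of_nat_diff algebra_simps)
qed

lemma pair_correlation_eq_sum:
  "pair_correlation \<gamma> s N x =
     1 / real N * (\<Sum>p\<in>off_diag N. of_bool (dist_nearest_int (x (fst p) - x (snd p) - \<gamma>) \<le> s / real N))"
proof -
  have "off_diag N \<inter> {p. dist_nearest_int (x (fst p) - x (snd p) - \<gamma>) \<le> s / real N} =
      {(m, n). m \<in> {1..N} \<and> n \<in> {1..N} \<and> m \<noteq> n \<and> dist_nearest_int (x m - x n - \<gamma>) \<le> s / real N}"
    by (auto simp: off_diag_def)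
  then show ?thesis by (simp add: pair_correlation_def)
qed

lemma pair_correlation_nonneg: "0 \<le> pair_correlation \<gamma> s N x"
  by (simp add: pair_correlation_def)

text \<open>Multiplication by \<open>N\<close> leaves the bare number of pairs, which grows with the
  index range and with the threshold.\<close>

lemma pair_correlation_mono:
  assumes "0 < N" "N \<le> N'" "s / real N \<le> s' / real N'"
  shows "real N * pair_correlation \<gamma> s N x \<le> real N' * pair_correlation \<gamma> s' N' x"
proof -
  let ?S = "\<lambda>s N. {(m, n). m \<in> {1..N} \<and> n \<in> {1..N} \<and> m \<noteq> n \<and> dist_nearest_int (x m - x n - \<gamma>) \<le> s / real N}"
  have "finite (?S s' N')" by (rule finite_subset[of _ "{1..N'} \<times> {1..N'}"]) auto
  moreover have "?S s N \<subseteq> ?S s' N'" using assms(2,3) by auto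
  ultimately have "card (?S s N) \<le> card (?S s' N')" by (rule card_mono)
  with assms show ?thesis by (simp add: pair_correlation_def)
qed

lemma ex_between_fourth_powers: "\<exists>k::nat. k ^ 4 \<le> N \<and> N < Suc k ^ 4"
proof (induction N)
  case 0
  show ?case by (intro exI[of _ 0]) simp
next
  case (Suc N)
  then obtain k where k: "k ^ 4 \<le> N" "N < Suc k ^ 4" by blast
  have "Suc k ^ 4 < Suc (Suc k) ^ 4" by (rule power_strict_mono) auto
  with k show ?case
    by (cases "Suc N < Suc k ^ 4") (auto intro: exI[of _ k] exI[of _ "Suc k"] simp del: power_Suc)
qed

text \<open>Passing from \<open>N\<close> to a neighbouring fourth power changes the threshold and
  the normalisation, each by at most the factor \<open>((k + 1) / k)^4\<close>. The first change is
  absorbed by \<open>s1\<close> or \<open>s2\<close>, the second is the explicit factor.\<close>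

lemma pair_correlation_between_fourth_powers:
  assumes k: "0 < k" "k ^ 4 \<le> N" "N \<le> Suc k ^ 4" and s: "0 \<le> s"
  shows "s1 * (real (Suc k) / real k) ^ 4 \<le> s \<Longrightarrow> 0 \<le> s1 \<Longrightarrow>
      pair_correlation \<gamma> s1 (k ^ 4) x * (real k / real (Suc k)) ^ 4 \<le> pair_correlation \<gamma> s N x"
    and "s * (real (Suc k) / real k) ^ 4 \<le> s2 \<Longrightarrow>
      pair_correlation \<gamma> s N x \<le> pair_correlation \<gamma> s2 (Suc k ^ 4) x * (real (Suc k) / real k) ^ 4"
proof -
  have "0 < k ^ 4" using k(1) by simp
  then have N: "0 < N" using k(2) by linarith
  have le: "real k ^ 4 \<le> real N" "real N \<le> real (Suc k) ^ 4"
    using k(2,3) by (simp_all flip: of_nat_power del: of_nat_Suc)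
  have k': "0 < real k ^ 4" "0 < real (Suc k) ^ 4" using k(1) by simp_all
  show "pair_correlation \<gamma> s1 (k ^ 4) x * (real k / real (Suc k)) ^ 4 \<le> pair_correlation \<gamma> s N x"
    if s1: "s1 * (real (Suc k) / real k) ^ 4 \<le> s" "0 \<le> s1"
  proof -
    have "s1 * real N \<le> s1 * real (Suc k) ^ 4" using s1(2) le(2) by (rule mult_left_mono[rotated])
    also have "\<dots> \<le> s * real k ^ 4" using s1(1) k' by (simp add: power_divide field_simps)
    finally have "s1 / real (k ^ 4) \<le> s / real N" using N k' by (simp add: field_simps)
    then have "real (k ^ 4) * pair_correlation \<gamma> s1 (k ^ 4) x \<le> real N * pair_correlation \<gamma> s N x"
      using \<open>0 < k ^ 4\<close> k(2) by (intro pair_correlation_mono)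
    also have "\<dots> \<le> real (Suc k) ^ 4 * pair_correlation \<gamma> s N x"
      using le(2) pair_correlation_nonneg by (rule mult_right_mono)
    finally show ?thesis using k' by (simp add: power_divide field_simps)
  qed
  show "pair_correlation \<gamma> s N x \<le> pair_correlation \<gamma> s2 (Suc k ^ 4) x * (real (Suc k) / real k) ^ 4"
    if s2: "s * (real (Suc k) / real k) ^ 4 \<le> s2"
  proof -
    have "s * real (Suc k) ^ 4 \<le> s2 * real k ^ 4" using s2 k' by (simp add: power_divide field_simps)
    also have "\<dots> \<le> s2 * real N"
      using le(1) order_trans[OF mult_nonneg_nonneg[OF s, of "(real (Suc k) / real k) ^ 4"] s2]
      by (intro mult_left_mono) auto
    finally have "s / real N \<le> s2 / real (Suc k ^ 4)" using N k' by (simp add: field_simps)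
    then have "real N * pair_correlation \<gamma> s N x \<le> real (Suc k ^ 4) * pair_correlation \<gamma> s2 (Suc k ^ 4) x"
      using N k(3) by (intro pair_correlation_mono)
    moreover have "real k ^ 4 * pair_correlation \<gamma> s N x \<le> real N * pair_correlation \<gamma> s N x"
      using le(1) pair_correlation_nonneg by (rule mult_right_mono)
    ultimately show ?thesis using k' by (simp add: power_divide field_simps)
  qed
qed

text \<open>Rational \<open>s1 < s < s2\<close> close to \<open>s\<close> sandwich the pair
  correlation; as \<open>(k + 1) / k\<close> tends to 1, the bounds tend to
  \<open>2 * s1 * L\<close> and \<open>2 * s2 * L\<close>. Convergence is assumed for rational
  parameters only, so that countably many null sets arise later.\<close>

lemma pair_correlation_tendsto_of_fourth_powers:
  assumes lim: "\<And>s. s \<in> \<rat> \<Longrightarrow> 0 < s \<Longrightarrow> (\<lambda>k. pair_correlation \<gamma> s (k ^ 4) x) \<longlonglongrightarrow> 2 * s * L"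
    and "0 \<le> L" "0 < s"
  shows "(\<lambda>N. pair_correlation \<gamma> s N x) \<longlonglongrightarrow> 2 * s * L"
proof (rule tendstoI)
  fix e :: real assume "0 < e"
  \<comment> \<open>The summand 1 in the denominator admits \<open>L = 0\<close>.\<close>
  define d where "d = e / (2 * L + 1)"
  have d: "0 < d" "2 * L * d < e" using \<open>0 < e\<close> \<open>0 \<le> L\<close> by (auto simp: d_def field_simps)
  obtain s1 where s1: "s1 \<in> \<rat>" "max 0 (s - d) < s1" "s1 < s"
    using Rats_dense_in_real[of "max 0 (s - d)" s] d(1) \<open>0 < s\<close> by auto
  obtain s2 where s2: "s2 \<in> \<rat>" "s < s2" "s2 < s + d"
    using Rats_dense_in_real[of s "s + d"] d(1) by auto
  have "2 * L * s2 \<le> 2 * L * (s + d)" "2 * L * (s - d) \<le> 2 * L * s1"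
    using \<open>0 \<le> L\<close> s1 s2 by (auto intro!: mult_left_mono)
  then have bounds: "2 * s2 * L < 2 * s * L + e" "2 * s * L - e < 2 * s1 * L"
    using d(2) by (auto simp: algebra_simps)
  have up: "(\<lambda>k. (real (Suc k) / real k) ^ 4) \<longlonglongrightarrow> 1 ^ 4"
    by (intro tendsto_power LIMSEQ_Suc_n_over_n)
  have down: "(\<lambda>k. (real k / real (Suc k)) ^ 4) \<longlonglongrightarrow> 1 ^ 4"
    by (intro tendsto_power LIMSEQ_n_over_Suc_n)
  have "(\<lambda>k. pair_correlation \<gamma> s2 (Suc k ^ 4) x * (real (Suc k) / real k) ^ 4) \<longlonglongrightarrow> 2 * s2 * L * 1 ^ 4"
    using lim[OF s2(1)] \<open>0 < s\<close> s2(2) up by (intro tendsto_mult LIMSEQ_Suc[of "\<lambda>k. pair_correlation \<gamma> s2 (k ^ 4) x"]) auto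
  then have e1: "eventually (\<lambda>k. pair_correlation \<gamma> s2 (Suc k ^ 4) x * (real (Suc k) / real k) ^ 4 < 2 * s * L + e) sequentially"
    using bounds(1) by (intro order_tendstoD) auto
  have "(\<lambda>k. pair_correlation \<gamma> s1 (k ^ 4) x * (real k / real (Suc k)) ^ 4) \<longlonglongrightarrow> 2 * s1 * L * 1 ^ 4"
    using lim[OF s1(1)] s1(2) down by (intro tendsto_mult) auto
  then have e2: "eventually (\<lambda>k. 2 * s * L - e < pair_correlation \<gamma> s1 (k ^ 4) x * (real k / real (Suc k)) ^ 4) sequentially"
    using bounds(2) by (intro order_tendstoD) auto
  have "(\<lambda>k. s * (real (Suc k) / real k) ^ 4) \<longlonglongrightarrow> s * 1 ^ 4"
    using up by (intro tendsto_mult tendsto_const)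
  then have e3: "eventually (\<lambda>k. s * (real (Suc k) / real k) ^ 4 < s2) sequentially"
    using s2(2) by (intro order_tendstoD) auto
  have "(\<lambda>k. s1 * (real (Suc k) / real k) ^ 4) \<longlonglongrightarrow> s1 * 1 ^ 4"
    using up by (intro tendsto_mult tendsto_const)
  then have e4: "eventually (\<lambda>k. s1 * (real (Suc k) / real k) ^ 4 < s) sequentially"
    using s1(3) by (intro order_tendstoD) auto
  have "eventually (\<lambda>k. \<forall>N. k ^ 4 \<le> N \<longrightarrow> N \<le> Suc k ^ 4 \<longrightarrow> dist (pair_correlation \<gamma> s N x) (2 * s * L) < e) sequentially"
    using e1 e2 e3 e4 eventually_gt_at_top[of 0]
  proof eventually_elim
    case (elim k)
    show ?case
    proof (intro allI impI)
      fix N assume N: "k ^ 4 \<le> N" "N \<le> Suc k ^ 4"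
      have "pair_correlation \<gamma> s N x < 2 * s * L + e"
        using pair_correlation_between_fourth_powers(2)[of k N s s2 \<gamma> x] N elim \<open>0 < s\<close> by linarith
      moreover have "2 * s * L - e < pair_correlation \<gamma> s N x"
        using pair_correlation_between_fourth_powers(1)[of k N s s1 \<gamma> x] N elim \<open>0 < s\<close> s1(2) by linarith
      ultimately show "dist (pair_correlation \<gamma> s N x) (2 * s * L) < e"
        by (simp add: dist_real_def abs_less_iff)
    qed
  qed
  then obtain k0 where k0: "\<And>k N. k0 \<le> k \<Longrightarrow> k ^ 4 \<le> N \<Longrightarrow> N \<le> Suc k ^ 4 \<Longrightarrow>
      dist (pair_correlation \<gamma> s N x) (2 * s * L) < e"
    unfolding eventually_sequentially by blast
  show "eventually (\<lambda>N. dist (pair_correlation \<gamma> s N x) (2 * s * L) < e) sequentially"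
    using eventually_ge_at_top[of "k0 ^ 4"]
  proof eventually_elim
    case (elim N)
    obtain k where k: "k ^ 4 \<le> N" "N < Suc k ^ 4" using ex_between_fourth_powers by blast
    have "k0 < Suc k"
      using elim k(2) by (intro power_less_imp_less_base[of k0 4 "Suc k"]) auto
    with k show ?case by (intro k0[of k]) auto
  qed
qed

section \<open>Second moments and almost sure convergence\<close>

text \<open>By independence the joint law is a product. Over each value of \<open>V\<close> in
  \<open>A\<close> the section of \<open>B\<close> has mass at most \<open>\<delta>\<close>, and
  other values contribute nothing.\<close>

lemma (in prob_space) prob_indep_section_le:
  assumes ind: "indep_var S V T W"
    and [measurable]: "A \<in> sets S" "B \<in> sets (S \<Otimes>\<^sub>M T)"
    and le: "\<And>v. v \<in> space S \<Longrightarrow> measure (distr M T W) (Pair v -` B) \<le> \<delta>"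
    and "0 \<le> \<delta>"
  shows "prob {\<omega> \<in> space M. V \<omega> \<in> A \<and> (V \<omega>, W \<omega>) \<in> B} \<le> prob {\<omega> \<in> space M. V \<omega> \<in> A} * \<delta>"
proof -
  have V [measurable]: "V \<in> measurable M S" and W [measurable]: "W \<in> measurable M T"
    and joint: "distr M S V \<Otimes>\<^sub>M distr M T W = distr M (S \<Otimes>\<^sub>M T) (\<lambda>\<omega>. (V \<omega>, W \<omega>))"
    using ind unfolding indep_var_distribution_eq by auto
  interpret W: prob_space "distr M T W" by (rule prob_space_distr) fact
  define C where "C = B \<inter> (A \<times> space T)"
  have [measurable]: "C \<in> sets (S \<Otimes>\<^sub>M T)" unfolding C_def by measurable
  have "emeasure M {\<omega> \<in> space M. V \<omega> \<in> A \<and> (V \<omega>, W \<omega>) \<in> B} = emeasure (distr M (S \<Otimes>\<^sub>M T) (\<lambda>\<omega>. (V \<omega>, W \<omega>))) C"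
    using measurable_space[OF W]
    by (subst emeasure_distr) (auto simp: C_def intro!: arg_cong[where f="emeasure M"])
  also have "\<dots> = emeasure (distr M S V \<Otimes>\<^sub>M distr M T W) C"
    by (simp only: joint)
  also have "\<dots> = (\<integral>\<^sup>+v. emeasure (distr M T W) (Pair v -` C) \<partial>distr M S V)"
    by (rule W.emeasure_pair_measure_alt) simp
  also have "\<dots> \<le> (\<integral>\<^sup>+v. ennreal \<delta> * indicator A v \<partial>distr M S V)"
  proof (rule nn_integral_mono)
    fix v assume "v \<in> space (distr M S V)"
    then have v: "v \<in> space S" by simp
    have "Pair v -` C = (if v \<in> A then Pair v -` B else {})"
      using sets.sets_into_space[OF \<open>B \<in> sets (S \<Otimes>\<^sub>M T)\<close>] by (auto simp: C_def space_pair_measure)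
    then show "emeasure (distr M T W) (Pair v -` C) \<le> ennreal \<delta> * indicator A v"
      using le[OF v] by (auto simp: W.emeasure_eq_measure intro: ennreal_leI)
  qed
  also have "\<dots> = ennreal \<delta> * emeasure (distr M S V) A"
    by (simp add: nn_integral_cmult)
  also have "emeasure (distr M S V) A = emeasure M {\<omega> \<in> space M. V \<omega> \<in> A}"
    by (subst emeasure_distr) (auto intro!: arg_cong[where f="emeasure M"])
  finally show ?thesis
    using \<open>0 \<le> \<delta>\<close> by (simp add: emeasure_eq_measure mult.commute flip: ennreal_mult)
qed

text \<open>Conditioning on \<open>V\<close> under the product law; it serves to compute the
  probability of a single close pair.\<close>

lemma (in prob_space) prob_indep_eq_integral_section:
  assumes ind: "indep_var S V T W" and [measurable]: "B \<in> sets (S \<Otimes>\<^sub>M T)"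
  shows "prob {\<omega> \<in> space M. (V \<omega>, W \<omega>) \<in> B} = (\<integral>v. measure (distr M T W) (Pair v -` B) \<partial>distr M S V)"
proof -
  have V [measurable]: "V \<in> measurable M S" and W [measurable]: "W \<in> measurable M T"
    and joint: "distr M S V \<Otimes>\<^sub>M distr M T W = distr M (S \<Otimes>\<^sub>M T) (\<lambda>\<omega>. (V \<omega>, W \<omega>))"
    using ind unfolding indep_var_distribution_eq by auto
  interpret W: prob_space "distr M T W" by (rule prob_space_distr) fact
  have [measurable]: "(\<lambda>v. measure (distr M T W) (Pair v -` B)) \<in> borel_measurable (distr M S V)"
    unfolding measure_def by (intro borel_measurable_enn2real W.measurable_emeasure_Pair) simp
  have "emeasure M {\<omega> \<in> space M. (V \<omega>, W \<omega>) \<in> B} = emeasure (distr M (S \<Otimes>\<^sub>M T) (\<lambda>\<omega>. (V \<omega>, W \<omega>))) B"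
    by (subst emeasure_distr) (auto intro!: arg_cong[where f="emeasure M"])
  also have "\<dots> = emeasure (distr M S V \<Otimes>\<^sub>M distr M T W) B"
    by (simp only: joint)
  also have "\<dots> = (\<integral>\<^sup>+v. emeasure (distr M T W) (Pair v -` B) \<partial>distr M S V)"
    by (rule W.emeasure_pair_measure_alt) simp
  also have "\<dots> = (\<integral>\<^sup>+v. ennreal (measure (distr M T W) (Pair v -` B)) \<partial>distr M S V)"
    by (simp add: W.emeasure_eq_measure)
  finally have "(\<integral>\<^sup>+v. ennreal (measure (distr M T W) (Pair v -` B)) \<partial>distr M S V) =
      ennreal (prob {\<omega> \<in> space M. (V \<omega>, W \<omega>) \<in> B})"
    by (simp add: emeasure_eq_measure)
  then show ?thesis
    by (subst integral_eq_nn_integral) auto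
qed

section \<open>Pair events of an independent sequence\<close>

locale iid_l2_density = l2_density g + prob_space M for g :: "real \<Rightarrow> real" and M :: "'a measure" +
  fixes X :: "nat \<Rightarrow> 'a \<Rightarrow> real" and \<gamma> :: real
  assumes indep: "indep_vars (\<lambda>_. borel) X {1..}"
    and distr_X: "\<And>n. 1 \<le> n \<Longrightarrow> distr M borel (X n) = \<mu>"
begin

definition close :: "real \<Rightarrow> nat \<times> nat \<Rightarrow> 'a set" where
  "close \<epsilon> p = {\<omega> \<in> space M. dist_nearest_int (X (fst p) \<omega> - X (snd p) \<omega> - \<gamma>) \<le> \<epsilon>}"

lemma measurable_X [measurable (raw)]: "1 \<le> n \<Longrightarrow> X n \<in> borel_measurable M"
  using indep unfolding indep_vars_def by auto

lemma close_events [measurable]: "1 \<le> fst p \<Longrightarrow> 1 \<le> snd p \<Longrightarrow> close \<epsilon> p \<in> events"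
  unfolding close_def by measurable

text \<open>Disjoint blocks of an independent family are independent. Equal indices within one block
  are allowed, so a single variable can enter as a doubled pair.\<close>

lemma indep_var_pair_pair:
  assumes "1 \<le> m" "1 \<le> n" "1 \<le> k" "1 \<le> l" "{m, n} \<inter> {k, l} = {}"
  shows "indep_var (borel \<Otimes>\<^sub>M borel) (\<lambda>\<omega>. (X m \<omega>, X n \<omega>)) (borel \<Otimes>\<^sub>M borel) (\<lambda>\<omega>. (X k \<omega>, X l \<omega>))"
proof -
  have "indep_var (borel \<Otimes>\<^sub>M borel) ((\<lambda>h. (h m, h n)) \<circ> (\<lambda>\<omega>. restrict (\<lambda>i. X i \<omega>) {m, n}))
      (borel \<Otimes>\<^sub>M borel) ((\<lambda>h. (h k, h l)) \<circ> (\<lambda>\<omega>. restrict (\<lambda>i. X i \<omega>) {k, l}))"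
    by (rule indep_var_compose[OF indep_var_restrict[OF indep]]) (use assms in auto)
  then show ?thesis by (simp add: comp_def)
qed

text \<open>Given \<open>X n = v\<close>, the event says that \<open>X m\<close> falls into the arc
  about \<open>v + \<gamma>\<close>.\<close>

lemma prob_close:
  assumes "1 \<le> m" "1 \<le> n" "m \<noteq> n"
  shows "prob (close \<epsilon> (m, n)) = pair_prob \<gamma> \<epsilon>"
proof -
  have "indep_var borel (fst \<circ> (\<lambda>\<omega>. (X n \<omega>, X n \<omega>))) borel (fst \<circ> (\<lambda>\<omega>. (X m \<omega>, X m \<omega>)))"
    using assms by (intro indep_var_compose[OF indep_var_pair_pair]) auto
  then have ind: "indep_var borel (X n) borel (X m)" by (simp add: comp_def)
  define B :: "(real \<times> real) set" where "B = {(v, w). dist_nearest_int (w - (v + \<gamma>)) \<le> \<epsilon>}"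
  have "B = {vw \<in> space (borel \<Otimes>\<^sub>M borel). dist_nearest_int (snd vw - (fst vw + \<gamma>)) \<le> \<epsilon>}"
    by (auto simp: B_def space_pair_measure)
  then have [measurable]: "B \<in> sets (borel \<Otimes>\<^sub>M borel)" by simp
  have "prob {\<omega> \<in> space M. (X n \<omega>, X m \<omega>) \<in> B} =
      (\<integral>v. measure (distr M borel (X m)) (Pair v -` B) \<partial>distr M borel (X n))"
    by (rule prob_indep_eq_integral_section[OF ind]) measurable
  then show ?thesis
    using assms by (simp add: distr_X close_def B_def pair_prob_def arc_def vimage_def algebra_simps)
qed

lemma prob_close_le: "p \<in> off_diag N \<Longrightarrow> 0 \<le> \<epsilon> \<Longrightarrow> prob (close \<epsilon> p) \<le> 2 * \<epsilon> * K"
  by (cases p) (auto simp: off_diag_def prob_close pair_prob_le)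

text \<open>\<open>l\<close> is the shared index and \<open>k\<close> the new one. Given
  \<open>X m\<close> and \<open>X n\<close>, the second event confines \<open>X k\<close> to an arc
  with known centre, and the probability of an arc is at most
  \<open>sqrt (2 * \<epsilon> * K)\<close> uniformly in the centre.\<close>

lemma prob_close_share_one_le:
  assumes "1 \<le> m" "1 \<le> n" "1 \<le> k" "k \<noteq> m" "k \<noteq> n" "l = m \<or> l = n" "0 \<le> \<epsilon>" "q = (k, l) \<or> q = (l, k)"
  shows "prob (close \<epsilon> (m, n) \<inter> close \<epsilon> q) \<le> prob (close \<epsilon> (m, n)) * sqrt (2 * \<epsilon> * K)"
proof -
  define h where "h v = (if l = m then fst v else snd v)" for v :: "real \<times> real"
  define A :: "(real \<times> real) set" where "A = {v. dist_nearest_int (fst v - snd v - \<gamma>) \<le> \<epsilon>}"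
  \<comment> \<open>The orientation of \<open>q\<close> decides the sign of \<open>\<gamma>\<close>:
    by evenness, \<open>X l - X k - \<gamma>\<close> is as far from the integers as
    \<open>X k - (X l - \<gamma>)\<close>.\<close>
  define c where "c v = (if q = (k, l) then h v + \<gamma> else h v - \<gamma>)" for v
  define B where "B = {(v, w :: real \<times> real). dist_nearest_int (fst w - c v) \<le> \<epsilon>}"
  have [measurable]: "h \<in> borel_measurable (borel \<Otimes>\<^sub>M borel)"
    unfolding h_def by measurable
  have [measurable]: "c \<in> borel_measurable (borel \<Otimes>\<^sub>M borel)"
    unfolding c_def by measurable
  have "A = {v \<in> space (borel \<Otimes>\<^sub>M borel). dist_nearest_int (fst v - snd v - \<gamma>) \<le> \<epsilon>}"
    by (simp add: A_def space_pair_measure)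
  then have A: "A \<in> sets (borel \<Otimes>\<^sub>M borel)" by simp
  have "B = {vw \<in> space ((borel \<Otimes>\<^sub>M borel) \<Otimes>\<^sub>M (borel \<Otimes>\<^sub>M borel)). dist_nearest_int (fst (snd vw) - c (fst vw)) \<le> \<epsilon>}"
    by (auto simp: B_def space_pair_measure)
  then have B: "B \<in> sets ((borel \<Otimes>\<^sub>M borel) \<Otimes>\<^sub>M (borel \<Otimes>\<^sub>M borel))" by simp
  \<comment> \<open>\<open>X k\<close> is doubled to fit the independence of pairs; \<open>B\<close>
    reads only its first copy.\<close>
  have "prob {\<omega> \<in> space M. (X m \<omega>, X n \<omega>) \<in> A \<and> ((X m \<omega>, X n \<omega>), (X k \<omega>, X k \<omega>)) \<in> B}
      \<le> prob {\<omega> \<in> space M. (X m \<omega>, X n \<omega>) \<in> A} * sqrt (2 * \<epsilon> * K)"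
  proof (rule prob_indep_section_le[OF indep_var_pair_pair A B])
    fix v
    have "Pair v -` B = {w \<in> space (borel \<Otimes>\<^sub>M borel). dist_nearest_int (fst w - c v) \<le> \<epsilon>}"
      by (auto simp: B_def space_pair_measure)
    moreover have "\<dots> \<in> sets (borel \<Otimes>\<^sub>M borel)" by measurable
    ultimately have "measure (distr M (borel \<Otimes>\<^sub>M borel) (\<lambda>\<omega>. (X k \<omega>, X k \<omega>))) (Pair v -` B) =
        prob {\<omega> \<in> space M. dist_nearest_int (X k \<omega> - c v) \<le> \<epsilon>}"
      using assms(3) by (subst measure_distr) (auto simp: space_pair_measure intro!: arg_cong[where f=prob])
    also have "\<dots> = measure (distr M borel (X k)) {x. dist_nearest_int (x - c v) \<le> \<epsilon>}"
      using assms(3) by (subst measure_distr) (auto intro!: arg_cong[where f=prob])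
    also have "\<dots> \<le> sqrt (2 * \<epsilon> * K)"
      using arc_le_sqrt[OF \<open>0 \<le> \<epsilon>\<close>, of "c v"] assms(3) by (simp add: distr_X arc_def)
    finally show "measure (distr M (borel \<Otimes>\<^sub>M borel) (\<lambda>\<omega>. (X k \<omega>, X k \<omega>))) (Pair v -` B) \<le> sqrt (2 * \<epsilon> * K)" .
  qed (use assms K_nonneg in auto)
  moreover have "{\<omega> \<in> space M. (X m \<omega>, X n \<omega>) \<in> A} = close \<epsilon> (m, n)"
    by (simp add: A_def close_def)
  moreover have "{\<omega> \<in> space M. (X m \<omega>, X n \<omega>) \<in> A \<and> ((X m \<omega>, X n \<omega>), (X k \<omega>, X k \<omega>)) \<in> B} = close \<epsilon> (m, n) \<inter> close \<epsilon> q"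
  proof -
    have hl: "h (X m \<omega>, X n \<omega>) = X l \<omega>" for \<omega> using assms(6) by (auto simp: h_def)
    have "dist_nearest_int (X k \<omega> - c (X m \<omega>, X n \<omega>)) = dist_nearest_int (X (fst q) \<omega> - X (snd q) \<omega> - \<gamma>)" for \<omega>
      using assms(8) dist_nearest_int_minus[of "X k \<omega> - X l \<omega> + \<gamma>"]
      by (auto simp: c_def hl algebra_simps)
    then show ?thesis by (auto simp: A_def B_def close_def)
  qed
  ultimately show ?thesis by simp
qed

lemma prob_close_disjoint:
  assumes "1 \<le> m" "1 \<le> n" "1 \<le> k" "1 \<le> l" "{m, n} \<inter> {k, l} = {}"
  shows "prob (close \<epsilon> (m, n) \<inter> close \<epsilon> (k, l)) = prob (close \<epsilon> (m, n)) * prob (close \<epsilon> (k, l))"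
proof -
  define A :: "(real \<times> real) set" where "A = {v. dist_nearest_int (fst v - snd v - \<gamma>) \<le> \<epsilon>}"
  have "A = {v \<in> space (borel \<Otimes>\<^sub>M borel). dist_nearest_int (fst v - snd v - \<gamma>) \<le> \<epsilon>}"
    by (simp add: A_def space_pair_measure)
  then have A: "A \<in> sets (borel \<Otimes>\<^sub>M borel)" by simp
  have eq: "(\<lambda>\<omega>. (X i \<omega>, X j \<omega>)) -` A \<inter> space M = close \<epsilon> (i, j)" for i j
    by (auto simp: A_def close_def)
  have "(\<lambda>\<omega>. ((X m \<omega>, X n \<omega>), (X k \<omega>, X l \<omega>))) -` (A \<times> A) \<inter> space M = close \<epsilon> (m, n) \<inter> close \<epsilon> (k, l)"
    by (auto simp: A_def close_def)
  with indep_varD[OF indep_var_pair_pair[OF assms] A A] show ?thesis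
    by (simp add: eq)
qed

section \<open>Covariances of pair events and the variance of the pair correlation\<close>

definition cov :: "real \<Rightarrow> nat \<times> nat \<Rightarrow> nat \<times> nat \<Rightarrow> real" where
  "cov \<epsilon> p q = prob (close \<epsilon> p \<inter> close \<epsilon> q) - prob (close \<epsilon> p) * prob (close \<epsilon> q)"

text \<open>Disjoint pairs are uncorrelated; otherwise the covariance is at most the joint
  probability. The first summand pays for pairs with the same two indices, the second for those
  sharing one.\<close>

lemma cov_le:
  assumes p: "p \<in> off_diag N" and q: "q \<in> off_diag N" and "0 \<le> \<epsilon>"
  shows "cov \<epsilon> p q \<le> 2 * \<epsilon> * K * of_bool (q \<in> {p, prod.swap p}) +
    2 * \<epsilon> * K * sqrt (2 * \<epsilon> * K) * of_bool (q \<in> {fst p, snd p} \<times> {1..N} \<union> {1..N} \<times> {fst p, snd p})"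
proof -
  obtain m n where mn: "p = (m, n)" by (cases p)
  obtain k l where kl: "q = (k, l)" by (cases q)
  have ge: "1 \<le> m" "1 \<le> n" "1 \<le> k" "1 \<le> l" "m \<noteq> n" "k \<noteq> l" and le: "k \<in> {1..N}" "l \<in> {1..N}"
    using p q by (auto simp: mn kl off_diag_def)
  let ?Q = "2 * \<epsilon> * K"
  have Q: "prob (close \<epsilon> p) \<le> ?Q" using prob_close_le[OF p \<open>0 \<le> \<epsilon>\<close>] .
  have Q0: "0 \<le> ?Q" using \<open>0 \<le> \<epsilon>\<close> K_nonneg by simp
  have cov: "cov \<epsilon> p q \<le> prob (close \<epsilon> p \<inter> close \<epsilon> q)" by (simp add: cov_def)
  \<comment> \<open>Each pair has distinct entries, so sharing both indices means equality up to a
    swap.\<close>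
  consider (disj) "{m, n} \<inter> {k, l} = {}" | (both) "q = p \<or> q = prod.swap p"
    | (k) "k \<notin> {m, n}" "l \<in> {m, n}" | (l) "l \<notin> {m, n}" "k \<in> {m, n}"
    using ge by (auto simp: mn kl)
  then show ?thesis
  proof cases
    case disj
    then have "cov \<epsilon> p q = 0" using prob_close_disjoint[OF ge(1-4)] by (simp add: cov_def mn kl)
    then show ?thesis using Q0 by simp
  next
    case both
    have "prob (close \<epsilon> p \<inter> close \<epsilon> q) \<le> prob (close \<epsilon> p)"
      using ge by (intro finite_measure_mono) (auto simp: mn)
    moreover have "0 \<le> ?Q * sqrt ?Q * of_bool (q \<in> {fst p, snd p} \<times> {1..N} \<union> {1..N} \<times> {fst p, snd p})"
      using \<open>0 \<le> \<epsilon>\<close> K_nonneg by (intro mult_nonneg_nonneg) auto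
    moreover have "?Q * of_bool (q \<in> {p, prod.swap p}) = ?Q" using both by simp
    ultimately show ?thesis using cov Q by linarith
  next
    case k
    have "prob (close \<epsilon> p \<inter> close \<epsilon> q) \<le> prob (close \<epsilon> p) * sqrt ?Q"
      unfolding mn kl using k ge \<open>0 \<le> \<epsilon>\<close> by (intro prob_close_share_one_le[of m n k l]) auto
    also have "\<dots> \<le> ?Q * sqrt ?Q" using Q Q0 by (intro mult_right_mono) auto
    finally show ?thesis using cov k le Q0 by (auto simp: mn kl)
  next
    case l
    have "prob (close \<epsilon> p \<inter> close \<epsilon> q) \<le> prob (close \<epsilon> p) * sqrt ?Q"
      unfolding mn kl using l ge \<open>0 \<le> \<epsilon>\<close> by (intro prob_close_share_one_le[of m n l k]) auto
    also have "\<dots> \<le> ?Q * sqrt ?Q" using Q Q0 by (intro mult_right_mono) auto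
    finally show ?thesis using cov l le Q0 by (auto simp: mn kl)
  qed
qed

text \<open>For fixed \<open>p\<close> at most two pairs have the same indices, and at most
  \<open>4 * N\<close> have an index in common with it.\<close>

lemma sum_cov_le:
  assumes p: "p \<in> off_diag N" and "0 \<le> \<epsilon>"
  shows "(\<Sum>q\<in>off_diag N. cov \<epsilon> p q) \<le> 2 * (2 * \<epsilon> * K) + 4 * real N * (2 * \<epsilon> * K * sqrt (2 * \<epsilon> * K))"
proof -
  let ?Q = "2 * \<epsilon> * K"
  let ?T = "{fst p, snd p} \<times> {1..N} \<union> {1..N} \<times> {fst p, snd p}"
  have Q0: "0 \<le> ?Q" using \<open>0 \<le> \<epsilon>\<close> K_nonneg by simp
  have "card (off_diag N \<inter> {p, prod.swap p}) \<le> card {p, prod.swap p}" by (intro card_mono) auto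
  also have "\<dots> \<le> 2" by (simp add: card_insert_if)
  finally have c1: "real (card (off_diag N \<inter> {p, prod.swap p})) \<le> 2" by linarith
  have c: "card {fst p, snd p} \<le> 2" by (simp add: card_insert_if)
  have "card (off_diag N \<inter> ?T) \<le> card ?T" by (intro card_mono) auto
  also have "\<dots> \<le> card ({fst p, snd p} \<times> {1..N}) + card ({1..N} \<times> {fst p, snd p})" by (rule card_Un_le)
  also have "\<dots> \<le> 2 * N + N * 2"
    unfolding card_cartesian_product using c by (intro add_mono mult_mono) auto
  finally have c2: "real (card (off_diag N \<inter> ?T)) \<le> 4 * real N" by linarith
  have "(\<Sum>q\<in>off_diag N. cov \<epsilon> p q) \<le>
      (\<Sum>q\<in>off_diag N. ?Q * of_bool (q \<in> {p, prod.swap p}) + ?Q * sqrt ?Q * of_bool (q \<in> ?T))"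
    using assms by (intro sum_mono cov_le)
  also have "\<dots> = ?Q * real (card (off_diag N \<inter> {p, prod.swap p})) + ?Q * sqrt ?Q * real (card (off_diag N \<inter> ?T))"
    unfolding sum.distrib sum_distrib_left[symmetric] by (simp only: sum_of_bool_eq finite_off_diag Collect_mem_eq)
  also have "\<dots> \<le> ?Q * 2 + ?Q * sqrt ?Q * (4 * real N)"
    using c1 c2 Q0 by (intro add_mono mult_left_mono) auto
  finally show ?thesis by (simp add: mult_ac)
qed

lemma pair_correlation_eq_sum_close:
  "\<omega> \<in> space M \<Longrightarrow> pair_correlation \<gamma> s N (\<lambda>n. X n \<omega>) =
     1 / real N * (\<Sum>p\<in>off_diag N. indicator (close (s / real N) p) \<omega>)"
  by (simp add: pair_correlation_eq_sum close_def indicator_def)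

text \<open>The expectation of the pair correlation: \<open>N * (N - 1)\<close> ordered pairs of
  equal probability, divided by \<open>N\<close>.\<close>

definition mean :: "real \<Rightarrow> nat \<Rightarrow> real" where
  "mean s N = (real N - 1) * pair_prob \<gamma> (s / real N)"

lemma mean_eq_sum: "1 \<le> N \<Longrightarrow> mean s N = 1 / real N * (\<Sum>p\<in>off_diag N. prob (close (s / real N) p))"
proof -
  assume "1 \<le> N"
  have "(\<Sum>p\<in>off_diag N. prob (close (s / real N) p)) = (\<Sum>p\<in>off_diag N. pair_prob \<gamma> (s / real N))"
    by (intro sum.cong refl) (auto simp: off_diag_def prob_close)
  then show ?thesis using \<open>1 \<le> N\<close> by (simp add: mean_def card_off_diag)
qed

lemma borel_measurable_pair_correlation [measurable]:
  "(\<lambda>\<omega>. pair_correlation \<gamma> s N (\<lambda>n. X n \<omega>)) \<in> borel_measurable M"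
proof -
  have "(\<lambda>\<omega>. 1 / real N * (\<Sum>p\<in>off_diag N. indicator (close (s / real N) p) \<omega>)) \<in> borel_measurable M"
    by (intro borel_measurable_times borel_measurable_sum borel_measurable_const borel_measurable_indicator close_events)
       (auto simp: off_diag_def)
  then show ?thesis
    by (subst measurable_cong[OF pair_correlation_eq_sum_close])
qed

text \<open>The variance is \<open>1 / N^2\<close> times the sum of all covariances. With
  \<open>Q = 2 * s * K / N\<close> each of the fewer than \<open>N^2\<close> pairs contributes at
  most \<open>2 * Q + 4 * N * Q * sqrt Q\<close>, which is of order
  \<open>1 / sqrt N\<close>.\<close>

lemma expectation_square_le:
  assumes "1 \<le> N" "0 < s"
  shows "(\<integral>\<^sup>+\<omega>. ennreal ((pair_correlation \<gamma> s N (\<lambda>n. X n \<omega>) - mean s N)\<^sup>2) \<partial>M)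
    \<le> ennreal ((4 * s * K + 8 * s * K * sqrt (2 * s * K)) / sqrt (real N))"
proof -
  define \<epsilon> where "\<epsilon> = s / real N"
  have \<epsilon>: "0 \<le> \<epsilon>" using assms by (simp add: \<epsilon>_def)
  \<comment> \<open>Centred indicators, so that the expectation of \<open>Y p * Y q\<close> is the
    covariance of the two events.\<close>
  define Y where "Y p \<omega> = indicator (close \<epsilon> p) \<omega> - prob (close \<epsilon> p)" for p \<omega>
  have ev: "close \<epsilon> p \<in> events" if "p \<in> off_diag N" for p
    using that by (auto simp: off_diag_def)
  have Y_eq: "Y p \<omega> * Y q \<omega> = indicator (close \<epsilon> p \<inter> close \<epsilon> q) \<omega> - prob (close \<epsilon> q) * indicator (close \<epsilon> p) \<omega>
      - prob (close \<epsilon> p) * indicator (close \<epsilon> q) \<omega> + prob (close \<epsilon> p) * prob (close \<epsilon> q)" for p q \<omega>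
    by (simp add: Y_def indicator_inter_arith algebra_simps)
  have int: "integrable M (\<lambda>\<omega>. Y p \<omega> * Y q \<omega>)" and cov: "expectation (\<lambda>\<omega>. Y p \<omega> * Y q \<omega>) = cov \<epsilon> p q"
    if "p \<in> off_diag N" "q \<in> off_diag N" for p q
    unfolding Y_eq using ev[OF that(1)] ev[OF that(2)]
    by (auto simp: cov_def prob_space emeasure_eq_measure)
  have eq: "(pair_correlation \<gamma> s N (\<lambda>n. X n \<omega>) - mean s N)\<^sup>2 =
      1 / (real N)\<^sup>2 * (\<Sum>p\<in>off_diag N. \<Sum>q\<in>off_diag N. Y p \<omega> * Y q \<omega>)" if "\<omega> \<in> space M" for \<omega>
  proof -
    have "pair_correlation \<gamma> s N (\<lambda>n. X n \<omega>) - mean s N = 1 / real N * (\<Sum>p\<in>off_diag N. Y p \<omega>)"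
      using that assms(1)
      by (simp add: pair_correlation_eq_sum_close mean_eq_sum Y_def \<epsilon>_def sum_subtractf diff_divide_distrib)
    then show ?thesis by (simp add: power_mult_distrib power_divide power2_eq_square sum_product)
  qed
  define Q where "Q = 2 * \<epsilon> * K"
  have "(\<integral>\<^sup>+\<omega>. ennreal ((pair_correlation \<gamma> s N (\<lambda>n. X n \<omega>) - mean s N)\<^sup>2) \<partial>M)
      = (\<integral>\<^sup>+\<omega>. ennreal (1 / (real N)\<^sup>2 * (\<Sum>p\<in>off_diag N. \<Sum>q\<in>off_diag N. Y p \<omega> * Y q \<omega>)) \<partial>M)"
    by (intro nn_integral_cong) (simp only: eq)
  also have "\<dots> = ennreal (\<integral>\<omega>. 1 / (real N)\<^sup>2 * (\<Sum>p\<in>off_diag N. \<Sum>q\<in>off_diag N. Y p \<omega> * Y q \<omega>) \<partial>M)"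
  proof (rule nn_integral_eq_integral)
    show "integrable M (\<lambda>\<omega>. 1 / (real N)\<^sup>2 * (\<Sum>p\<in>off_diag N. \<Sum>q\<in>off_diag N. Y p \<omega> * Y q \<omega>))"
      using int by (intro integrable_mult_right Bochner_Integration.integrable_sum) auto
    show "AE \<omega> in M. 0 \<le> 1 / (real N)\<^sup>2 * (\<Sum>p\<in>off_diag N. \<Sum>q\<in>off_diag N. Y p \<omega> * Y q \<omega>)"
      using eq[symmetric] by (intro AE_I2) simp
  qed
  also have "(\<integral>\<omega>. 1 / (real N)\<^sup>2 * (\<Sum>p\<in>off_diag N. \<Sum>q\<in>off_diag N. Y p \<omega> * Y q \<omega>) \<partial>M) =
      1 / (real N)\<^sup>2 * (\<Sum>p\<in>off_diag N. \<Sum>q\<in>off_diag N. cov \<epsilon> p q)"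
    using int cov by (simp add: Bochner_Integration.integral_sum Bochner_Integration.integrable_sum)
  also have "\<dots> \<le> 1 / (real N)\<^sup>2 * (\<Sum>p\<in>off_diag N. 2 * Q + 4 * real N * (Q * sqrt Q))"
    unfolding Q_def using \<epsilon> by (intro mult_left_mono sum_mono sum_cov_le) auto
  also have "\<dots> = (real (card (off_diag N)) / (real N)\<^sup>2) * (2 * Q + 4 * real N * (Q * sqrt Q))"
    by simp
  also have "\<dots> \<le> 1 * (2 * Q + 4 * real N * (Q * sqrt Q))"
    using \<epsilon> K_nonneg assms(1)
    by (intro mult_right_mono) (auto simp: card_off_diag Q_def power2_eq_square divide_simps)
  also have "\<dots> = 4 * s * K / real N + 8 * s * K * sqrt (2 * s * K) / sqrt (real N)"
    using assms by (simp add: Q_def \<epsilon>_def real_sqrt_divide field_simps)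
  \<comment> \<open>Weakening \<open>1 / N\<close> to \<open>1 / sqrt N\<close> lets one constant
    cover both summands.\<close>
  also have "\<dots> \<le> 4 * s * K / sqrt (real N) + 8 * s * K * sqrt (2 * s * K) / sqrt (real N)"
  proof -
    have "sqrt (real N) \<le> real N"
      using assms(1) by (intro real_le_lsqrt) (auto simp: power2_eq_square)
    then show ?thesis
      using assms K_nonneg by (intro add_right_mono divide_left_mono) auto
  qed
  also have "\<dots> = (4 * s * K + 8 * s * K * sqrt (2 * s * K)) / sqrt (real N)"
    by (simp add: add_divide_distrib)
  finally show ?thesis by (simp add: ennreal_leI)
qed

text \<open>At \<open>N = (k + 1)^4\<close> the second moments are \<open>O(1 / (k + 1)^2)\<close>.
  Thus the sum of the squared deviations has finite expectation, is almost surely finite, and its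
  terms tend to 0. The shift to \<open>Suc k\<close> avoids \<open>N = 0\<close>.\<close>

lemma AE_fourth_powers_tendsto_mean:
  assumes "0 < s"
  shows "AE \<omega> in M. (\<lambda>k. pair_correlation \<gamma> s (Suc k ^ 4) (\<lambda>n. X n \<omega>) - mean s (Suc k ^ 4)) \<longlonglongrightarrow> 0"
proof -
  define C where "C = 4 * s * K + 8 * s * K * sqrt (2 * s * K)"
  have C: "0 \<le> C" using assms K_nonneg by (simp add: C_def)
  define D where "D k \<omega> = pair_correlation \<gamma> s (Suc k ^ 4) (\<lambda>n. X n \<omega>) - mean s (Suc k ^ 4)" for k \<omega>
  have [measurable]: "D k \<in> borel_measurable M" for k unfolding D_def by measurable
  have bound: "(\<integral>\<^sup>+\<omega>. ennreal ((D k \<omega>)\<^sup>2) \<partial>M) \<le> ennreal (C / (real (Suc k))\<^sup>2)" for k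
  proof -
    have "sqrt (real (Suc k ^ 4)) = (real (Suc k))\<^sup>2"
      by (rule real_sqrt_unique) (simp_all flip: power_mult)
    then show ?thesis
      using expectation_square_le[of "Suc k ^ 4" s] assms one_le_power[of "Suc k" 4]
      by (simp add: D_def C_def del: power_Suc of_nat_Suc of_nat_power)
  qed
  have summ: "summable (\<lambda>k. C / (real (Suc k))\<^sup>2)"
    using summable_mult[OF inverse_power_summable[of 2, THEN summable_Suc_iff[THEN iffD2]], of C]
    by (simp add: field_simps)
  have "(\<integral>\<^sup>+\<omega>. (\<Sum>k. ennreal ((D k \<omega>)\<^sup>2)) \<partial>M) = (\<Sum>k. \<integral>\<^sup>+\<omega>. ennreal ((D k \<omega>)\<^sup>2) \<partial>M)"
    by (rule nn_integral_suminf) measurable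
  also have "\<dots> \<le> (\<Sum>k. ennreal (C / (real (Suc k))\<^sup>2))"
    by (intro suminf_le bound) auto
  also have "\<dots> < \<infinity>"
    using summ C by (subst suminf_ennreal2) auto
  finally have "AE \<omega> in M. (\<Sum>k. ennreal ((D k \<omega>)\<^sup>2)) \<noteq> \<infinity>"
    by (intro nn_integral_PInf_AE) auto
  then show ?thesis
  proof eventually_elim
    case (elim \<omega>)
    then have "summable (\<lambda>k. (D k \<omega>)\<^sup>2)" by (intro summable_suminf_not_top) auto
    then have "(\<lambda>k. (D k \<omega>)\<^sup>2) \<longlonglongrightarrow> 0" by (rule summable_LIMSEQ_zero)
    then have "(\<lambda>k. sqrt ((D k \<omega>)\<^sup>2)) \<longlonglongrightarrow> sqrt 0" by (rule tendsto_real_sqrt)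
    then have "(\<lambda>k. \<bar>D k \<omega>\<bar>) \<longlonglongrightarrow> 0" by simp
    then show ?case unfolding D_def by (rule tendsto_rabs_zero_cancel)
  qed
qed

section \<open>Limit of the means and the almost sure limit\<close>

definition J :: real where "J = (\<integral>y. g y * g (frac (y + \<gamma>)) \<partial>leb01)"

lemma J_nonneg: "0 \<le> J"
  unfolding J_def by (simp add: g_nonneg)

text \<open>With \<open>\<epsilon> = s / N\<close> the mean is \<open>2 * s * (1 - 1 / N)\<close>
  times the quotient \<open>pair_prob \<gamma> \<epsilon> / (2 * \<epsilon>)\<close>, whose limit is
  \<open>J\<close>.\<close>

lemma mean_fourth_powers_tendsto:
  assumes diff: "AE t in lborel. t \<in> {0..<1} \<longrightarrow> ((\<lambda>\<epsilon>. arc \<epsilon> t / (2 * \<epsilon>)) \<longlongrightarrow> g t) (at_right 0)" and "0 < s"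
  shows "(\<lambda>k. mean s (Suc k ^ 4)) \<longlonglongrightarrow> 2 * s * J"
proof -
  define \<epsilon> where "\<epsilon> k = s / real (Suc k ^ 4)" for k
  have inv: "(\<lambda>k. 1 / real (Suc k ^ 4)) \<longlonglongrightarrow> 0"
    by real_asymp
  have "(\<lambda>k. s * (1 / real (Suc k ^ 4))) \<longlonglongrightarrow> s * 0" by (intro tendsto_mult tendsto_const inv)
  then have "\<epsilon> \<longlonglongrightarrow> 0" by (simp add: \<epsilon>_def[abs_def])
  moreover have "0 < \<epsilon> k" for k using \<open>0 < s\<close> by (simp add: \<epsilon>_def del: of_nat_power)
  ultimately have "(\<lambda>k. pair_prob \<gamma> (\<epsilon> k) / (2 * \<epsilon> k)) \<longlonglongrightarrow> J"
    unfolding J_def by (intro pair_prob_asymp diff)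
  then have "(\<lambda>k. 2 * s * (1 - 1 / real (Suc k ^ 4)) * (pair_prob \<gamma> (\<epsilon> k) / (2 * \<epsilon> k))) \<longlonglongrightarrow> 2 * s * (1 - 0) * J"
    by (intro tendsto_mult tendsto_diff tendsto_const inv)
  moreover have "2 * s * (1 - 1 / real (Suc k ^ 4)) * (pair_prob \<gamma> (\<epsilon> k) / (2 * \<epsilon> k)) = mean s (Suc k ^ 4)" for k
  proof -
    have "0 < real (Suc k ^ 4)" by (simp del: of_nat_power)
    then show ?thesis unfolding mean_def \<epsilon>_def using \<open>0 < s\<close> by (simp add: divide_simps del: of_nat_power power_Suc)
  qed
  ultimately show ?thesis by simp
qed

text \<open>One null set serves all rational \<open>s\<close>; outside it the interpolation between
  fourth powers is deterministic and reaches every real \<open>s > 0\<close>.\<close>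

theorem AE_pair_correlation_tendsto:
  assumes "AE t in lborel. t \<in> {0..<1} \<longrightarrow> ((\<lambda>\<epsilon>. arc \<epsilon> t / (2 * \<epsilon>)) \<longlongrightarrow> g t) (at_right 0)"
  shows "AE \<omega> in M. \<forall>s>0. (\<lambda>N. pair_correlation \<gamma> s N (\<lambda>n. X n \<omega>)) \<longlonglongrightarrow> 2 * s * J"
proof -
  have "AE \<omega> in M. \<forall>s\<in>\<rat> \<inter> {0<..}.
      (\<lambda>k. pair_correlation \<gamma> s (Suc k ^ 4) (\<lambda>n. X n \<omega>) - mean s (Suc k ^ 4)) \<longlonglongrightarrow> 0"
    by (subst AE_ball_countable) (auto intro: countable_rat AE_fourth_powers_tendsto_mean countable_Int1)
  then show ?thesis
  proof eventually_elim
    case (elim \<omega>)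
    have "(\<lambda>k. pair_correlation \<gamma> s (k ^ 4) (\<lambda>n. X n \<omega>)) \<longlonglongrightarrow> 2 * s * J" if "s \<in> \<rat>" "0 < s" for s
    proof -
      have "(\<lambda>k. (pair_correlation \<gamma> s (Suc k ^ 4) (\<lambda>n. X n \<omega>) - mean s (Suc k ^ 4)) + mean s (Suc k ^ 4)) \<longlonglongrightarrow> 0 + 2 * s * J"
        using elim that by (intro tendsto_add mean_fourth_powers_tendsto assms) auto
      then show ?thesis
        by (subst filterlim_sequentially_Suc[symmetric]) simp
    qed
    then show ?case using J_nonneg by (auto intro: pair_correlation_tendsto_of_fourth_powers)
  qed
qed

end

section \<open>Proof of the theorem\<close>

lemma negligible_of_AE_lborel:
  assumes "AE x in lborel. P x"
  shows "negligible {x. \<not> P x}"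
proof -
  obtain N where N: "{x \<in> space lborel. \<not> P x} \<subseteq> N" "emeasure lborel N = 0" "N \<in> sets lborel"
    using AE_E[OF assms] by blast
  then have "N \<in> null_sets lebesgue"
    by (intro null_sets_completionI) auto
  then show ?thesis
    using N(1) by (auto intro: negligible_subset simp: negligible_iff_null_sets[symmetric])
qed

text \<open>\<open>g\<close> is Lebesgue measurable and may be negative on a null set. A Borel
  representative, truncated at 0 and cut to \<open>{0..<1}\<close>, agrees with it almost everywhere
  there, since a monotone function has nonnegative derivative.\<close>

lemma ex_borel_density:
  assumes "distribution_function01 G" "in_L2_01 g" "is_density_of g G"
  obtains g0 where "g0 \<in> borel_measurable borel" "\<And>x. 0 \<le> g0 x" "\<And>x. x \<notin> {0..<1} \<Longrightarrow> g0 x = 0"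
    "AE x in lborel. x \<in> {0..<1} \<longrightarrow> 0 < x \<and> g0 x = g x \<and> (G has_real_derivative g0 x) (at x)"
proof -
  have "g \<in> borel_measurable (lebesgue_on {0..1})"
    using assms(2) by (simp add: in_L2_01_def)
  then have "(\<lambda>x. if x \<in> {0..1} then g x else 0) \<in> borel_measurable (completion lborel)"
    by (intro borel_measurable_if_I) auto
  then obtain h where h [measurable]: "h \<in> borel_measurable lborel"
    and gh: "AE x in lborel. (if x \<in> {0..1} then g x else 0) = h x"
    using completion_ex_borel_measurable_real by blast
  define g0 where "g0 x = (if x \<in> {0..<1} then max 0 (h x) else 0)" for x
  have "AE x in lebesgue. x \<in> {0..1} \<longrightarrow> (G has_real_derivative g x) (at x within {0..1})"
    using assms(3) by (simp add: is_density_of_def AE_restrict_space_iff)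
  then have der: "AE x in lborel. x \<in> {0..1} \<longrightarrow> (G has_real_derivative g x) (at x within {0..1})"
    by (simp add: AE_completion_iff)
  show ?thesis
  proof
    show "g0 \<in> borel_measurable borel" using h unfolding g0_def by measurable
    show "AE x in lborel. x \<in> {0..<1} \<longrightarrow> 0 < x \<and> g0 x = g x \<and> (G has_real_derivative g0 x) (at x)"
      using gh der AE_lborel_singleton[of 0]
    proof eventually_elim
      case (elim x)
      show ?case
      proof
        assume "x \<in> {0..<1}"
        with elim(3) have x: "0 < x" "x < 1" by auto
        \<comment> \<open>At interior points the derivative within \<open>{0..1}\<close> is the full
          derivative; the endpoint 0 has been discarded as a null set.\<close>
        then have "interior {0..1} = {0<..<1 :: real}" "x \<in> interior {0..1}" by auto
        with elim(2) x have D: "(G has_real_derivative g x) (at x)"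
          by (metis at_within_interior atLeastAtMost_iff less_imp_le)
        then have "0 \<le> g x"
          using assms(1) \<open>x \<in> interior {0..1}\<close>
          by (intro mono_on_imp_deriv_nonneg[of "{0..1}" G]) (auto simp: distribution_function01_def)
        then have "g0 x = g x" using elim(1) x by (simp add: g0_def max_def)
        with D x show "0 < x \<and> g0 x = g x \<and> (G has_real_derivative g0 x) (at x)" by simp
      qed
    qed
  qed (auto simp: g0_def)
qed

text \<open>The fundamental theorem gives a gauge integral, which for a nonnegative Borel integrand
  is the Lebesgue integral.\<close>

lemma nn_integral_density_interval:
  assumes [measurable]: "g0 \<in> borel_measurable borel" and nonneg: "\<And>x. 0 \<le> g0 x"
    and ac: "abs_continuous_on_interval 0 1 G"
    and der: "AE x in lborel. x \<in> {0..<1} \<longrightarrow> (G has_real_derivative g0 x) (at x)"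
    and ab: "0 \<le> a" "a \<le> b" "b \<le> 1"
  shows "(\<integral>\<^sup>+x. ennreal (g0 x) * indicator {a..b} x \<partial>lborel) = ennreal (G b - G a)"
proof -
  \<comment> \<open>The point 1 is added because the derivative is only known almost everywhere on
    \<open>{0..<1}\<close>.\<close>
  let ?N = "insert 1 {x. \<not> (x \<in> {0..<1} \<longrightarrow> (G has_real_derivative g0 x) (at x))}"
  have "(g0 has_integral (G b - G a)) {a..b}"
  proof (rule fundamental_theorem_of_calculus_abs_continuous)
    show "abs_continuous_on_interval a b G"
      using abs_continuous_on_interval_subset[OF ac] ab by simp
    show "negligible ?N"
      using negligible_of_AE_lborel[OF der] by simp
    show "(G has_real_derivative g0 x) (at x within {a..b})" if "x \<in> {a..b} - ?N" for x
      using that ab by (auto intro: has_field_derivative_at_within)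
  qed fact
  then have "((\<lambda>x. if x \<in> {a..b} then g0 x else 0) has_integral (G b - G a)) UNIV"
    by (simp only: has_integral_restrict_UNIV)
  then have "(\<integral>\<^sup>+x. ennreal (if x \<in> {a..b} then g0 x else 0) \<partial>lborel) = ennreal (G b - G a)"
    by (intro nn_integral_has_integral_lborel) (auto simp: nonneg)
  moreover have "ennreal (g0 x) * indicator {a..b} x = ennreal (if x \<in> {a..b} then g0 x else 0)" for x
    by (simp add: indicator_def)
  ultimately show ?thesis by simp
qed

text \<open>For small \<open>h\<close> the part of the arc in the unit interval is
  \<open>{t - h..t + h}\<close>, whose mass over \<open>2 * h\<close> is the mean of the right and
  left difference quotients of \<open>G\<close>.\<close>

lemma (in l2_density) arc_over_length_tendsto:
  assumes G: "\<And>a b. 0 \<le> a \<Longrightarrow> a \<le> b \<Longrightarrow> b \<le> 1 \<Longrightarrow> measure \<mu> {a..b} = G b - G a"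
    and t: "0 < t" "t < 1" and der: "(G has_real_derivative g t) (at t)"
  shows "((\<lambda>\<epsilon>. arc \<epsilon> t / (2 * \<epsilon>)) \<longlongrightarrow> g t) (at_right 0)"
proof -
  have "((\<lambda>h. (G (t + h) - G t) / h) \<longlongrightarrow> g t) (at_right 0)" and
    left: "((\<lambda>h. (G (t + h) - G t) / h) \<longlongrightarrow> g t) (at_left 0)"
    using der unfolding DERIV_def by (auto simp: filterlim_at_split)
  moreover have "((\<lambda>h. (G (t + - h) - G t) / - h) \<longlongrightarrow> g t) (at_right 0)"
    using left by (simp add: filterlim_at_left_to_right)
  ultimately have "((\<lambda>h. ((G (t + h) - G t) / h + (G (t + - h) - G t) / - h) / 2) \<longlongrightarrow> (g t + g t) / 2) (at_right 0)"
    by (intro tendsto_intros) auto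
  then have "((\<lambda>h. ((G (t + h) - G t) / h + (G (t + - h) - G t) / - h) / 2) \<longlongrightarrow> g t) (at_right 0)"
    by simp
  moreover have "eventually (\<lambda>h. ((G (t + h) - G t) / h + (G (t + - h) - G t) / - h) / 2 = arc h t / (2 * h)) (at_right 0)"
  proof -
    have "eventually (\<lambda>h. h \<in> {0<..<min t (1 - t)}) (at_right 0)"
      using t by (intro eventually_at_right_real) auto
    then show ?thesis
    proof eventually_elim
      case (elim h)
      then have h: "0 < h" "h < t" "h < 1 - t" by auto
      have iff: "dist_nearest_int (x - t) \<le> h \<longleftrightarrow> x \<in> {t - h..t + h}" if x: "x \<in> {0..<1}" for x
      proof
        assume le: "dist_nearest_int (x - t) \<le> h"
        obtain k where k: "dist_nearest_int (x - t) = \<bar>x - t - of_int k\<bar>"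
          using dist_nearest_int_attained by blast
        have "\<bar>x - t - of_int k\<bar> \<le> h" using k le by simp
        \<comment> \<open>As \<open>h < t\<close> and \<open>h < 1 - t\<close>, the arc does not
          wrap around, which forces \<open>k = 0\<close>.\<close>
        then have "of_int k < (1 :: real)" "(-1 :: real) < of_int k" using x h by auto
        then have "k = 0" by linarith
        with k le show "x \<in> {t - h..t + h}" by (simp add: abs_le_iff)
      next
        assume "x \<in> {t - h..t + h}"
        then show "dist_nearest_int (x - t) \<le> h"
          using dist_nearest_int_le[of "x - t" 0] by auto
      qed
      have [measurable]: "{x. dist_nearest_int (x - t) \<le> h} \<in> sets borel" by measurable
      have "g x * indicator {x. dist_nearest_int (x - t) \<le> h} x = g x * indicator {t - h..t + h} x" for x
        using iff[of x] g_zero[of x] by (cases "x \<in> {0..<1}") (auto simp: indicator_def)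
      then have "arc h t = measure \<mu> {t - h..t + h}"
        by (simp only: arc_def measure_\<mu>_eq_integral[OF \<open>_ \<in> sets borel\<close>] measure_\<mu>_eq_integral[of "{t - h..t + h}"]
            atLeastAtMost_borel)
      also have "\<dots> = G (t + h) - G (t - h)" using h t by (intro G) auto
      finally show ?case using h by (simp add: field_simps)
    qed
  qed
  ultimately show ?thesis by (rule Lim_transform_eventually)
qed

text \<open>Open half-lines generate the Borel sets, are stable under intersection, and match the
  strict inequality in the distribution function.\<close>

lemma (in prob_space) distr_eq_density_of_cdf:
  fixes Y :: "'a \<Rightarrow> real" and G :: "real \<Rightarrow> real"
  assumes [measurable]: "Y \<in> borel_measurable M" "g0 \<in> borel_measurable borel"
    and zero: "\<And>x. x \<notin> {0..<1} \<Longrightarrow> g0 x = 0"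
    and int: "\<And>t. t \<in> {0..1} \<Longrightarrow> (\<integral>\<^sup>+x. ennreal (g0 x) * indicator {0..t} x \<partial>lborel) = ennreal (G t)"
    and G: "G 0 = 0" "G 1 = 1"
    and cdf: "\<And>t. t \<in> {0..1} \<Longrightarrow> prob {\<omega> \<in> space M. Y \<omega> < t} = G t"
  shows "distr M borel Y = density lborel (\<lambda>x. ennreal (g0 x))"
proof (rule measure_eqI_generator_eq[where E="range lessThan" and \<Omega>=UNIV and A="\<lambda>n. {..<real n}"])
  have "{..<a} \<inter> {..<b} = {..<min a b}" for a b :: real by auto
  then show "Int_stable (range lessThan :: real set set)"
    by (auto simp: Int_stable_def simp del: lessThan_subset_iff)
  show "sets (distr M borel Y) = sigma_sets UNIV (range lessThan)"
    "sets (density lborel (\<lambda>x. ennreal (g0 x))) = sigma_sets UNIV (range lessThan)"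
    by (simp_all add: borel_Iio)
  show "(\<Union>i. {..<real i}) = UNIV" using reals_Archimedean2 by auto
  show "emeasure (distr M borel Y) {..<real i} \<noteq> \<infinity>" for i
    by (subst emeasure_distr) (auto simp: emeasure_eq_measure)
  fix A :: "real set" assume "A \<in> range lessThan"
  then obtain t where A: "A = {..<t}" by auto
  \<comment> \<open>\<open>t\<close> is clamped to the unit interval; beyond it, monotonicity of
    probability with \<open>G 0 = 0\<close> and \<open>G 1 = 1\<close> fixes the value.\<close>
  define c where "c = max 0 (min 1 t)"
  have c: "c \<in> {0..1}" by (auto simp: c_def)
  have "prob {\<omega> \<in> space M. Y \<omega> < t} = G c"
  proof -
    consider "t < 0" | "0 \<le> t" "t \<le> 1" | "1 < t" by linarith
    then show ?thesis
    proof cases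
      case 1
      then have "prob {\<omega> \<in> space M. Y \<omega> < t} \<le> prob {\<omega> \<in> space M. Y \<omega> < 0}"
        by (intro finite_measure_mono) auto
      with 1 cdf[of 0] G show ?thesis by (simp add: c_def measure_le_0_iff)
    next
      case 2
      with cdf[of t] show ?thesis by (simp add: c_def)
    next
      case 3
      then have "prob {\<omega> \<in> space M. Y \<omega> < t} \<ge> prob {\<omega> \<in> space M. Y \<omega> < 1}"
        by (intro finite_measure_mono) auto
      moreover have "prob {\<omega> \<in> space M. Y \<omega> < 1} = 1" "G c = 1" using cdf[of 1] G 3 by (auto simp: c_def)
      ultimately show ?thesis using prob_le_1[of "{\<omega> \<in> space M. Y \<omega> < t}"] G by linarith
    qed
  qed
  moreover have "emeasure (distr M borel Y) A = emeasure M {\<omega> \<in> space M. Y \<omega> < t}"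
    unfolding A by (subst emeasure_distr) (auto intro!: arg_cong[where f="emeasure M"])
  ultimately have 1: "emeasure (distr M borel Y) A = ennreal (G c)"
    by (simp add: emeasure_eq_measure)
  \<comment> \<open>Where \<open>g0\<close> is nonzero, the two indicators can differ only at
    \<open>t\<close> and at 0.\<close>
  have ae: "AE x in lborel. ennreal (g0 x) * indicator {..<t} x = ennreal (g0 x) * indicator {0..c} x"
    using AE_lborel_singleton[of t] AE_lborel_singleton[of 0]
  proof eventually_elim
    case (elim x)
    then show ?case
      using zero[of x] by (cases "x \<in> {0..<1}") (auto simp: c_def indicator_def max_def min_def split: if_splits)
  qed
  have "emeasure (density lborel (\<lambda>x. ennreal (g0 x))) A = (\<integral>\<^sup>+x. ennreal (g0 x) * indicator {..<t} x \<partial>lborel)"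
    unfolding A by (subst emeasure_density) auto
  also have "\<dots> = (\<integral>\<^sup>+x. ennreal (g0 x) * indicator {0..c} x \<partial>lborel)"
    using ae by (rule nn_integral_cong_AE)
  also have "\<dots> = ennreal (G c)" by (rule int[OF c])
  finally show "emeasure (distr M borel Y) A = emeasure (density lborel (\<lambda>x. ennreal (g0 x))) A"
    using 1 by simp
qed auto

theorem theorem2:
  fixes \<gamma> :: real
    and G g :: "real \<Rightarrow> real"
    and M :: "'a measure"
    and X :: "nat \<Rightarrow> 'a \<Rightarrow> real"
  assumes "distribution_function01 G"
    and "abs_continuous_on_interval 0 1 G"
    and "in_L2_01 g"
    and "is_density_of g G"
    and "prob_space M"
    and "prob_space.indep_vars M (\<lambda>_. borel) X {1..}"
    and "\<And>n t. n \<ge> 1 \<Longrightarrow> t \<in> {0..1} \<Longrightarrow> measure M {\<omega> \<in> space M. X n \<omega> < t} = G t"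
  shows "AE \<omega> in M. \<forall>s>0.
           (\<lambda>N. pair_correlation \<gamma> s N (\<lambda>n. X n \<omega>)) \<longlonglongrightarrow>
             2 * s * (\<integral>x. g x * g (frac (x + \<gamma>)) \<partial>(lebesgue_on {0..1}))"
proof -
  interpret prob_space M by fact
  have G01: "G 0 = 0" "G 1 = 1" using assms(1) by (auto simp: distribution_function01_def)
  obtain g0 where g0 [measurable]: "g0 \<in> borel_measurable borel"
    and nonneg: "\<And>x. 0 \<le> g0 x" and zero: "\<And>x. x \<notin> {0..<1} \<Longrightarrow> g0 x = 0"
    and ae: "AE x in lborel. x \<in> {0..<1} \<longrightarrow> 0 < x \<and> g0 x = g x \<and> (G has_real_derivative g0 x) (at x)"
    using ex_borel_density[OF assms(1,3,4)] by blast
  have der: "AE x in lborel. x \<in> {0..<1} \<longrightarrow> (G has_real_derivative g0 x) (at x)"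
    using ae by eventually_elim auto
  note int = nn_integral_density_interval[OF g0 nonneg assms(2) der]
  have X_meas: "X n \<in> borel_measurable M" if "1 \<le> n" for n
    using assms(6) that unfolding indep_vars_def by auto
  have distr: "distr M borel (X n) = density lborel (\<lambda>x. ennreal (g0 x))" if "1 \<le> n" for n
    using int[of 0] G01 assms(7)[OF that] by (intro distr_eq_density_of_cdf X_meas that g0 zero) auto
  have g0_eq: "negligible {x. \<not> (x \<in> {0..<1} \<longrightarrow> g0 x = g x)}"
    by (rule negligible_of_AE_lborel) (use ae in eventually_elim, auto)
  have square: "integrable lborel (\<lambda>x. (g0 x)\<^sup>2)"
  proof -
    have "integrable lebesgue (\<lambda>x. indicator {0..1} x *\<^sub>R (g x)\<^sup>2)"
      using assms(3) by (simp add: in_L2_01_def integrable_restrict_space)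
    then have "integrable lebesgue (\<lambda>x. (g0 x)\<^sup>2)"
    proof (rule integrable_cong_AE_imp)
      show "(\<lambda>x. (g0 x)\<^sup>2) \<in> borel_measurable lebesgue"
        by (intro measurable_completion) measurable
      have "AE x in lebesgue. x \<in> {0..<1} \<longrightarrow> g0 x = g x" "AE x in lebesgue. x \<noteq> 1"
        using ae AE_lborel_singleton[of 1] by (auto simp: AE_completion_iff elim: AE_mp)
      then show "AE x in lebesgue. indicator {0..1} x *\<^sub>R (g x)\<^sup>2 = (g0 x)\<^sup>2"
      proof eventually_elim
        case (elim x)
        then show ?case using zero[of x] by (cases "x \<in> {0..<1}") (auto simp: indicator_def)
      qed
    qed
    then show ?thesis by (simp add: integrable_completion)
  qed
  \<comment> \<open>The density has total mass 1 because it is the law of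
    \<open>X 1\<close>.\<close>
  have "prob_space (distr M borel (X 1))" by (intro prob_space_distr X_meas) simp
  then have "prob_space (density lborel (\<lambda>x. ennreal (g0 x)))" by (simp add: distr)
  then have l2: "l2_density g0"
    using g0 nonneg zero square by (intro l2_density.intro)
  have "iid_l2_density_axioms g0 M X"
    by (rule iid_l2_density_axioms.intro) (use assms(6) distr in \<open>auto simp: l2_density.\<mu>_def[OF l2]\<close>)
  then interpret D: iid_l2_density g0 M X \<gamma>
    by (intro iid_l2_density.intro l2 assms(5))
  have arcs: "AE t in lborel. t \<in> {0..<1} \<longrightarrow> ((\<lambda>\<epsilon>. D.arc \<epsilon> t / (2 * \<epsilon>)) \<longlongrightarrow> g0 t) (at_right 0)"
    using ae
  proof eventually_elim
    case (elim t)
    have "measure D.\<mu> {a..b} = G b - G a" if ab: "0 \<le> a" "a \<le> b" "b \<le> 1" for a b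
    proof -
      have "G a \<le> G b"
        using assms(1) ab by (auto simp: distribution_function01_def intro: mono_onD)
      moreover have "emeasure D.\<mu> {a..b} = ennreal (G b - G a)"
        unfolding D.\<mu>_def using int[OF ab] by (subst emeasure_density) auto
      ultimately show ?thesis by (simp add: measure_def)
    qed
    then have "0 < t \<Longrightarrow> t < 1 \<Longrightarrow> (G has_real_derivative g0 t) (at t) \<Longrightarrow> ((\<lambda>\<epsilon>. D.arc \<epsilon> t / (2 * \<epsilon>)) \<longlongrightarrow> g0 t) (at_right 0)"
      by (rule D.arc_over_length_tendsto)
    with elim show ?case unfolding atLeastLessThan_iff by blast
  qed
  \<comment> \<open>\<open>D.J\<close> uses the Borel version \<open>g0\<close> on the half-open
    interval and has to be carried over to \<open>g\<close> and the closed interval.\<close>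
  have "D.J = (\<integral>x. g x * g (frac (x + \<gamma>)) \<partial>(lebesgue_on {0..1}))"
  proof -
    let ?f = "\<lambda>x. g0 x * g0 (frac (x + \<gamma>))" and ?h = "\<lambda>x. g x * g (frac (x + \<gamma>))"
    have J: "D.J = (\<integral>x. ?f x \<partial>lborel)"
      unfolding D.J_def by (rule D.integral_unit_eq) (simp add: zero)
    have "integrable D.leb01 ?f"
      by (rule integrable_mult_of_square_integrable)
        (auto intro!: measurable_restrict_space1 D.integrable_g_square_unit D.integral_frac_shift_g_square)
    then have "integrable lborel (\<lambda>x. indicator {0..<1} x *\<^sub>R ?f x)"
      by (simp add: integrable_restrict_space)
    moreover have ind: "indicator A x *\<^sub>R ?f x = ?f x" if "{0..<1} \<subseteq> A" for A x
      using zero[of x] that by (cases "x \<in> {0..<1}") (auto simp: indicator_def)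
    have f01: "(\<lambda>x. indicator {0..<1} x *\<^sub>R ?f x) = ?f" "(\<lambda>x. indicator {0..1} x *\<^sub>R ?f x) = ?f"
      by (rule ext, rule ind, force)+
    ultimately have f: "integrable lborel ?f" by simp
    have f_abs: "?f absolutely_integrable_on {0..1}"
      unfolding set_integrable_def f01(2) by (rule integrable_completion[THEN iffD2]) (use f in auto)
    \<comment> \<open>Off this set both factors agree: the last set is the rotated exceptional set
      of \<open>g0\<close> and \<open>g\<close>, null by rotation invariance, and 1 is missing from
      the half-open interval.\<close>
    let ?N = "insert 1 ({x. \<not> (x \<in> {0..<1} \<longrightarrow> g0 x = g x)} \<union>
      {x. \<not> (x \<in> {0..<1} \<longrightarrow> g0 (frac (x + \<gamma>)) = g (frac (x + \<gamma>)))})"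
    have "AE x in lborel. x \<in> {0..<1} \<longrightarrow> g0 x = g x"
      using ae by eventually_elim auto
    from negligible_of_AE_lborel[OF AE_frac_shift[OF this, of \<gamma>]]
    have N: "negligible ?N" using g0_eq by simp
    have eq: "?h x = ?f x" if "x \<in> {0..1} - ?N" for x using that by auto
    \<comment> \<open>Integrability of the product built from \<open>g\<close> is inherited from the
      Borel version across the null set.\<close>
    have h_abs: "?h absolutely_integrable_on {0..1}"
      by (rule absolutely_integrable_spike[OF f_abs N eq])
    have "(\<integral>x. ?h x \<partial>(lebesgue_on {0..1})) = integral {0..1} ?h"
      by (rule lebesgue_integral_eq_integral) (use h_abs in \<open>auto simp: set_integrable_def integrable_restrict_space\<close>)
    also have "\<dots> = integral {0..1} ?f"
      by (rule integral_spike[OF N]) (use eq in auto)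
    also have "\<dots> = (LINT x:{0..1}|lebesgue. ?f x)"
      by (rule set_lebesgue_integral_eq_integral(2)[OF f_abs, symmetric])
    also have "\<dots> = (\<integral>x. ?f x \<partial>lborel)"
      unfolding set_lebesgue_integral_def f01(2) by (rule integral_completion) measurable
    finally show ?thesis using J by simp
  qed
  with D.AE_pair_correlation_tendsto[OF arcs] show ?thesis by simp
qed

end
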